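(* There exists a constant $C(p)$ depending on $p$ such that the smoothness condition $$\|u(\cdot,0)\|_{H^p}\le E,\quad\text{with}\quad p>0,\ E>0,$$ is equivalent to the logarithmic source condition $$u(\cdot,0)=f_q(\bar A^*\bar A)\,w\quad\text{with}\quad \|w\|_{L^2}\le\rho,\quad \rho=C(p)E,$$ where $q=p/(2\tau)$ and $f_q$ is defined by $f_q(\lambda)=(-\ln\lambda)^{-q}$ for all $\lambda\in(0,1)$.
   Context: Let $n\in\mathbb{N}$, $T>0$, $\tau\in(0,1]$, and let $\gamma$ be a positive integrable function on $(0,T)$; these are fixed. The Fourier transform is $\hat f(\xi)=\mathcal{F}(f)(\xi)=\int_{\mathbb{R}^n}f(x)e^{-2\pi i x\cdot\xi}\,dx$. The function $u$ solves the final value problem $\partial_t u(x,t)+\gamma(t)(-\Delta_x)^\tau u(x,t)=0$ for $x\in\mathbb{R}^n$, $t\in(0,T)$, with $u(\cdot,T)=g\in L^2(\mathbb{R}^n)$, where $\mathcal{F}((-\Delta_x)^\tau f)(\xi)=|2\pi\xi|^{2\tau}\mathcal{F}(f)(\xi)$; $u(\cdot,0)\in L^2(\mathbb{R}^n)$ is the unknown initial distribution. Equivalently, $Au(\cdot,0)=g$, where $A:L^2(\mathbb{R}^n)\to L^2(\mathbb{R}^n)$ is the bounded operator $Af=\mathcal{F}^{-1}(\psi\hat f)$ with $\psi(\xi)=\exp\left(-|2\pi\xi|^{2\tau}\int_0^T\gamma(\lambda)\,d\lambda\right)$. The normalized operator is $\bar A=A/\sqrt e$, so that the operator norm of $\bar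 A^*\bar A$ is at most $e^{-1}$. The operator $f_q(\bar A^*\bar A)$ is defined by functional calculus, i.e. it is the Fourier multiplier with symbol $f_q(\psi(\xi)^2/e)$. Here $w\in L^2(\mathbb{R}^n)$, $\|\cdot\|_{L^2}$ is the norm of $L^2(\mathbb{R}^n)$, and $\|\cdot\|_{H^p}$ is the Sobolev norm on $\mathbb{R}^n$, $\|f\|_{H^p}^2=\int_{\mathbb{R}^n}(1+|\xi|^2)^p|\hat f(\xi)|^2\,d\xi$.
   Formalization: Equivalence with one constant C(p) fails in general; proved with two constants: the smoothness condition with E implies the source condition with ρ = C(p)E, and the source condition with ρ = c(p)E implies the smoothness condition with E. *)

theory Defs
  imports "HOL-Analysis.Analysis"
begin

text \<open>
  Elements of $L^2$ are represented by functions; equality in $L^2$ is equality almost everywhere.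
\<close>

definition L2_space :: "('a::euclidean_space \<Rightarrow> complex) set" where
  "L2_space = {f \<in> borel_measurable lborel. integrable lborel (\<lambda>x. (cmod (f x))\<^sup>2)}"

definition L2_norm :: "('a::euclidean_space \<Rightarrow> complex) \<Rightarrow> real" where
  "L2_norm f = sqrt (LINT x|lborel. (cmod (f x))\<^sup>2)"

text \<open>
  The extended nonnegative integral is used here because the Bochner integral of a function
  that is not integrable is 0.
\<close>

definition L2_tendsto ::
    "(nat \<Rightarrow> 'a::euclidean_space \<Rightarrow> complex) \<Rightarrow> ('a \<Rightarrow> complex) \<Rightarrow> bool" where
  "L2_tendsto fs f \<longleftrightarrow>
     (\<lambda>k. \<integral>\<^sup>+x. ennreal ((cmod (fs k x - f x))\<^sup>2) \<partial>lborel) \<longlonglongrightarrow> 0"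

definition fourier :: "('a::euclidean_space \<Rightarrow> complex) \<Rightarrow> 'a \<Rightarrow> complex" where
  "fourier f \<xi> = (LINT x|lborel. f x * exp (- 2 * pi * \<i> * complex_of_real (x \<bullet> \<xi>)))"

text \<open>
  The Fourier transform on $L^2$ is the continuous extension of \<^const>\<open>fourier\<close> from
  $L^1 \cap L^2$. The choice operators below select representatives of classes modulo null sets;
  existence and uniqueness up to null sets is the theorem of Plancherel.
\<close>

definition L2_fourier :: "('a::euclidean_space \<Rightarrow> complex) \<Rightarrow> 'a \<Rightarrow> complex" where
  "L2_fourier f = (SOME F. F \<in> L2_space \<and>
     (\<exists>fs. (\<forall>k. fs k \<in> L2_space \<and> integrable lborel (fs k)) \<and>
           L2_tendsto fs f \<and> L2_tendsto (\<lambda>k. fourier (fs k)) F))"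

definition L2_inv_fourier :: "('a::euclidean_space \<Rightarrow> complex) \<Rightarrow> 'a \<Rightarrow> complex" where
  "L2_inv_fourier G = (SOME f. f \<in> L2_space \<and> (AE \<xi> in lborel. L2_fourier f \<xi> = G \<xi>))"

definition fourier_multiplier ::
    "('a::euclidean_space \<Rightarrow> real) \<Rightarrow> ('a \<Rightarrow> complex) \<Rightarrow> 'a \<Rightarrow> complex" where
  "fourier_multiplier m f = L2_inv_fourier (\<lambda>\<xi>. complex_of_real (m \<xi>) * L2_fourier f \<xi>)"

definition sobolev_space :: "real \<Rightarrow> ('a::euclidean_space \<Rightarrow> complex) set" where
  "sobolev_space p = {f \<in> L2_space.
     integrable lborel (\<lambda>\<xi>. (1 + (norm \<xi>)\<^sup>2) powr p * (cmod (L2_fourier f \<xi>))\<^sup>2)}"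

definition sobolev_norm :: "real \<Rightarrow> ('a::euclidean_space \<Rightarrow> complex) \<Rightarrow> real" where
  "sobolev_norm p f =
     sqrt (LINT \<xi>|lborel. (1 + (norm \<xi>)\<^sup>2) powr p * (cmod (L2_fourier f \<xi>))\<^sup>2)"

definition psi :: "real \<Rightarrow> real \<Rightarrow> (real \<Rightarrow> real) \<Rightarrow> 'a::euclidean_space \<Rightarrow> real" where
  "psi T \<tau> \<gamma> \<xi> =
     exp (- (norm ((2 * pi) *\<^sub>R \<xi>) powr (2 * \<tau>) * (LINT t:{0<..<T}|lebesgue. \<gamma> t)))"

text \<open>
  The operator $A$ sends the initial value $u(\cdot,0)$ to the final value $u(\cdot,T)$ of
  $\partial_t u + \gamma(t) (-\Delta)^\tau u = 0$.
\<close>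

definition final_value_op ::
    "real \<Rightarrow> real \<Rightarrow> (real \<Rightarrow> real) \<Rightarrow> ('a::euclidean_space \<Rightarrow> complex) \<Rightarrow> 'a \<Rightarrow> complex" where
  "final_value_op T \<tau> \<gamma> = fourier_multiplier (psi T \<tau> \<gamma>)"

text \<open>
  Functional calculus $h \mapsto h(\bar A^* \bar A)$ for $\bar A = A / \sqrt e$: since
  $\bar A^* \bar A$ is the multiplier with symbol $\psi^2 / e$, with values in $(0, 1/e]$,
  the operator $h(\bar A^* \bar A)$ is the multiplier with symbol $h(\psi^2 / e)$.
\<close>

definition normal_op_calculus ::
    "real \<Rightarrow> real \<Rightarrow> (real \<Rightarrow> real) \<Rightarrow> (real \<Rightarrow> real) \<Rightarrow>
     ('a::euclidean_space \<Rightarrow> complex) \<Rightarrow> 'a \<Rightarrow> complex" where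
  "normal_op_calculus T \<tau> \<gamma> h = fourier_multiplier (\<lambda>\<xi>. h ((psi T \<tau> \<gamma> \<xi>)\<^sup>2 / exp 1))"

definition log_index :: "real \<Rightarrow> real \<Rightarrow> real" where
  "log_index q t = (- ln t) powr (- q)"

definition smoothness_condition ::
    "real \<Rightarrow> real \<Rightarrow> ('a::euclidean_space \<Rightarrow> complex) \<Rightarrow> bool" where
  "smoothness_condition p E f \<longleftrightarrow> f \<in> sobolev_space p \<and> sobolev_norm p f \<le> E"

definition log_source_condition ::
    "real \<Rightarrow> real \<Rightarrow> (real \<Rightarrow> real) \<Rightarrow> real \<Rightarrow> real \<Rightarrow> ('a::euclidean_space \<Rightarrow> complex) \<Rightarrow> bool" where
  "log_source_condition T \<tau> \<gamma> q \<rho> f \<longleftrightarrow>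
     (\<exists>w \<in> L2_space. (AE x in lborel. f x = normal_op_calculus T \<tau> \<gamma> (log_index q) w x) \<and>
        L2_norm w \<le> \<rho>)"

end

theory Submission
  imports Defs "HOL-Probability.Characteristic_Functions"
begin

text \<open>
  Both conditions are statements about weighted $L^2$ norms of the Fourier transform of
  $u(\cdot,0)$. With $M = 2 (2\pi)^{2\tau} \int_0^T \gamma$, the symbol
  $f_q(\psi(\xi)^2/e)$ equals $(1 + M |\xi|^{2\tau})^{-q}$, which is comparable to
  $(1 + |\xi|^2)^{-\tau q} = (1 + |\xi|^2)^{-p/2}$; so the equivalence follows from the theorem
  of Plancherel. For the latter, Gaussian damping and Fubini give
  $\int |\hat f|^2 e^{-2 \pi^2 a^2 |\xi|^2} d\xi = \langle f * \phi_a, f \rangle$ with a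
  Gaussian approximate identity $\phi_a$. The right side is at most $\|f\|^2$, and it tends to
  $\|f\|^2$ for bounded continuous $f$, a dense class. Moreover $f * \phi_a$ is itself an inverse
  Fourier transform, so the range of the isometry is dense, hence everything by completeness.
\<close>

subsection \<open>Gaussian functions\<close>

text \<open>\<open>L2_fourier\<close> and \<open>L2_inv_fourier\<close> are choices, so nothing is
  known of them until a transform is shown to exist, to be unique up to null sets and to reach every
  element of \<open>L2_space\<close>. Surjectivity matters as much as isometry: a multiplier
  operator has the intended transform only because the product with the symbol has a preimage.
  Plancherel splits unevenly. The bound of the transform by the function holds for every integrable
  function and follows from the inequality of arithmetic and geometric means under the Gaussian. It
  makes the transform continuous in the square norm, so the reverse bound is needed only on a dense
  class. The division by e makes -ln(psi^2/e) equal to 1 plus a nonnegative term; hence the bracket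
  never falls below 1 and the symbol lies in (0,1]. Two constants occur because the ratio of
  (1+|xi|^2)^tau to 1 + M |xi|^(2 tau) is bounded above and below, but it is constant only for tau =
  1 and M = 1. Otherwise the best constants of the two implications differ.\<close>

definition gauss :: "'a::euclidean_space \<Rightarrow> real" where
  "gauss x = (\<Prod>b\<in>Basis. std_normal_density (x \<bullet> b))"

lemma sum_Basis_inner_square: "(\<Sum>b\<in>Basis. (x \<bullet> b)\<^sup>2) = (norm x)\<^sup>2"
  unfolding power2_norm_eq_inner unfolding power2_eq_square by (rule euclidean_inner[symmetric])

text \<open>The product in the definition suits integration coordinate by coordinate; this radial
  form suits scaling and comparison with \<open>damp\<close>.\<close>

lemma gauss_eq:
  "gauss (x :: 'a::euclidean_space) = exp (- (norm x)\<^sup>2 / 2) / sqrt (2 * pi) ^ DIM('a)"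
proof -
  have "gauss x = (\<Prod>b\<in>(Basis::'a set). exp (- (x \<bullet> b)\<^sup>2 / 2)) / sqrt (2 * pi) ^ DIM('a)"
    by (simp add: gauss_def std_normal_density_def prod_dividef)
  also have "(\<Prod>b\<in>(Basis::'a set). exp (- (x \<bullet> b)\<^sup>2 / 2)) = exp (- (norm x)\<^sup>2 / 2)"
    by (simp add: exp_sum[symmetric] sum_negf sum_divide_distrib[symmetric]
        sum_Basis_inner_square)
  finally show ?thesis .
qed

lemma gauss_nonneg [simp]: "gauss x \<ge> 0"
  by (simp add: gauss_def prod_nonneg)

lemma gauss_measurable [measurable]: "gauss \<in> borel_measurable borel"
  unfolding gauss_def by measurable

text \<open>Lebesgue measure on a Euclidean space is the image of the product of one-dimensional
  copies over \<open>Basis\<close>, so a product of coordinate functions integrates factor by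
  factor. The first argument of \<open>f\<close> lets the factor at \<open>b\<close> depend on the
  frequency coordinate \<open>t \<bullet> b\<close>.\<close>

lemma
  fixes f :: "real \<Rightarrow> real \<Rightarrow> 'c::{real_normed_field, banach, second_countable_topology}"
  assumes int: "\<And>t. integrable lborel (f t)" and meas: "\<And>t. f t \<in> borel_measurable borel"
  shows lborel_integrable_prod_Basis:
      "integrable lborel (\<lambda>x::'a::euclidean_space. \<Prod>b\<in>Basis. f (t \<bullet> b) (x \<bullet> b))"
    and lborel_integral_prod_Basis:
      "(LINT x|lborel. (\<Prod>b\<in>Basis. f (t \<bullet> b) ((x::'a) \<bullet> b))) = (\<Prod>b\<in>Basis. (LINT s|lborel. f (t \<bullet> b) s))"
proof -
  interpret product_sigma_finite "\<lambda>_::'a. lborel :: real measure"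
    by standard
  let ?T = "\<lambda>x::'a \<Rightarrow> real. \<Sum>b\<in>Basis. x b *\<^sub>R b"
  note meas[measurable]
  have eq: "(\<Prod>b\<in>Basis. f (t \<bullet> b) (?T x \<bullet> b)) = (\<Prod>b\<in>Basis. f (t \<bullet> b) (x b))" for x
    by simp
  show "integrable lborel (\<lambda>x::'a. \<Prod>b\<in>Basis. f (t \<bullet> b) (x \<bullet> b))"
    unfolding lborel_eq[where 'a='a]
    by (subst integrable_distr_eq) (auto simp: eq intro!: product_integrable_prod int)
  show "(LINT x|lborel. (\<Prod>b\<in>Basis. f (t \<bullet> b) ((x::'a) \<bullet> b))) = (\<Prod>b\<in>Basis. (LINT s|lborel. f (t \<bullet> b) s))"
    unfolding lborel_eq[where 'a='a]
    by (subst integral_distr) (auto simp: eq intro!: product_integral_prod int)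
qed

lemma gauss_integrable [simp]: "integrable lborel (gauss :: 'a::euclidean_space \<Rightarrow> real)"
  using lborel_integrable_prod_Basis[of "\<lambda>_. std_normal_density" "0::'a"]
  by (simp add: gauss_def[abs_def])

lemma gauss_integral: "(LINT x|lborel. gauss (x::'a::euclidean_space)) = 1"
  using lborel_integral_prod_Basis[of "\<lambda>_. std_normal_density" "0::'a"]
  by (simp add: gauss_def)

text \<open>The exponential of a sum over \<open>Basis\<close> splits into factors, which reduces
  the claim to the characteristic function of the one-dimensional normal distribution.\<close>

lemma gauss_char:
  "(LINT x|lborel. complex_of_real (gauss x) * exp (\<i> * complex_of_real (x \<bullet> t))) =
    complex_of_real (exp (- (norm t)\<^sup>2 / 2))" for t :: "'a::euclidean_space"
proof -
  let ?f = "\<lambda>t s::real. complex_of_real (std_normal_density s) * exp (\<i> * complex_of_real (s * t))"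
  have meas: "?f t \<in> borel_measurable borel" for t
    by measurable
  have int: "integrable lborel (?f t)" for t
    by (rule Bochner_Integration.integrable_bound[where f = std_normal_density])
      (auto simp: norm_mult)
  have 1: "(LINT s|lborel. ?f t s) = complex_of_real (exp (- t\<^sup>2 / 2))" for t
  proof -
    have "(LINT s|lborel. ?f t s) = char std_normal_distribution t"
      unfolding char_def
      by (subst integral_density) (auto simp: scaleR_conv_of_real mult_ac intro!: Bochner_Integration.integral_cong)
    then show ?thesis
      by (simp add: char_std_normal_distribution)
  qed
  have "complex_of_real (gauss x) * exp (\<i> * complex_of_real (x \<bullet> t)) =
      (\<Prod>b\<in>Basis. ?f (t \<bullet> b) (x \<bullet> b))" for x
    by (subst euclidean_inner) (simp add: gauss_def sum_distrib_left exp_sum prod.distrib)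
  then have "(LINT x|lborel. complex_of_real (gauss x) * exp (\<i> * complex_of_real (x \<bullet> t))) =
     (\<Prod>b\<in>Basis. complex_of_real (exp (- (t \<bullet> b)\<^sup>2 / 2)))"
    using lborel_integral_prod_Basis[of ?f t, OF int meas] by (simp only: 1)
  also have "\<dots> = complex_of_real (exp (- (norm t)\<^sup>2 / 2))"
    unfolding of_real_prod[symmetric]
    by (simp add: exp_sum[symmetric] sum_negf sum_divide_distrib[symmetric]
        sum_Basis_inner_square)
  finally show ?thesis .
qed

section \<open>Affine changes of variables and the damping factor\<close>

lemma
  fixes h :: "'a::euclidean_space \<Rightarrow> 'b::{banach, second_countable_topology}"
  assumes [measurable]: "h \<in> borel_measurable borel" and c: "c \<noteq> 0"
  shows lborel_integrable_affine: "integrable lborel (\<lambda>x. h (t + c *\<^sub>R x)) \<longleftrightarrow> integrable lborel h"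
    and lborel_integral_affine:
      "(LINT x|lborel. h x) = \<bar>c\<bar> ^ DIM('a) *\<^sub>R (LINT x|lborel. h (t + c *\<^sub>R x))"
proof -
  have c': "\<bar>c\<bar> ^ DIM('a) > 0"
    using c by simp
  have "integrable lborel h \<longleftrightarrow>
      integrable (density (distr lborel borel (\<lambda>x. t + c *\<^sub>R x)) (\<lambda>_. \<bar>c\<bar>^DIM('a))) h"
    using lborel_affine[OF c, of t] by simp
  also have "\<dots> \<longleftrightarrow> integrable lborel (\<lambda>x. \<bar>c\<bar> ^ DIM('a) *\<^sub>R h (t + c *\<^sub>R x))"
    using c' by (subst integrable_density) (auto simp: integrable_distr_eq)
  also have "\<dots> \<longleftrightarrow> integrable lborel (\<lambda>x. h (t + c *\<^sub>R x))"
  proof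
    assume "integrable lborel (\<lambda>x. \<bar>c\<bar> ^ DIM('a) *\<^sub>R h (t + c *\<^sub>R x))"
    then have "integrable lborel (\<lambda>x. inverse (\<bar>c\<bar> ^ DIM('a)) *\<^sub>R \<bar>c\<bar> ^ DIM('a) *\<^sub>R h (t + c *\<^sub>R x))"
      by (rule integrable_scaleR_right)
    then show "integrable lborel (\<lambda>x. h (t + c *\<^sub>R x))"
      using c' by (subst (asm) scaleR_scaleR) simp
  qed (rule integrable_scaleR_right)
  finally show "integrable lborel (\<lambda>x. h (t + c *\<^sub>R x)) \<longleftrightarrow> integrable lborel h" ..
  have "(LINT x|lborel. h x) =
      (LINT x|density (distr lborel borel (\<lambda>x. t + c *\<^sub>R x)) (\<lambda>_. \<bar>c\<bar>^DIM('a)). h x)"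
    using lborel_affine[OF c, of t] by simp
  also have "\<dots> = (LINT x|lborel. \<bar>c\<bar> ^ DIM('a) *\<^sub>R h (t + c *\<^sub>R x))"
    using c' by (subst integral_density) (auto simp: integral_distr)
  finally show "(LINT x|lborel. h x) = \<bar>c\<bar> ^ DIM('a) *\<^sub>R (LINT x|lborel. h (t + c *\<^sub>R x))"
    by simp
qed

lemma nn_integral_lborel_translate:
  fixes h :: "'a::euclidean_space \<Rightarrow> ennreal"
  assumes [measurable]: "h \<in> borel_measurable borel"
  shows "(\<integral>\<^sup>+x. h (x - t) \<partial>lborel) = (\<integral>\<^sup>+x. h x \<partial>lborel)"
  by (subst (2) lborel_distr_plus[of "- t", symmetric]) (simp add: nn_integral_distr)

text \<open>
  Normalized so that the Fourier transform of \<^term>\<open>damp a\<close> is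
  $a^{-n}$ \<^term>\<open>gauss\<close> at scale $a$.
\<close>

definition damp :: "real \<Rightarrow> 'a::euclidean_space \<Rightarrow> real" where
  "damp a \<xi> = exp (- (norm ((2 * pi * a) *\<^sub>R \<xi>))\<^sup>2 / 2)"

lemma damp_eq_gauss:
  "damp a (\<xi> :: 'a::euclidean_space) = sqrt (2 * pi) ^ DIM('a) * gauss ((2 * pi * a) *\<^sub>R \<xi>)"
  by (simp add: damp_def gauss_eq)

lemma damp_pos [simp]: "damp a \<xi> > 0" and damp_nonneg [simp]: "damp a \<xi> \<ge> 0"
  by (simp_all add: damp_def)

lemma damp_le_1 [simp]: "damp a \<xi> \<le> 1"
  by (simp add: damp_def)

lemma damp_measurable [measurable]: "damp a \<in> borel_measurable borel"
  unfolding damp_def by measurable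

lemma damp_integrable:
  assumes "a > 0" shows "integrable lborel (damp a :: 'a::euclidean_space \<Rightarrow> real)"
  using lborel_integrable_affine[of gauss "2 * pi * a" "0::'a"] assms
  by (simp add: damp_eq_gauss[abs_def])

lemma damp_tendsto_1: "(\<lambda>n. damp (1 / real (Suc n)) \<xi>) \<longlonglongrightarrow> 1"
proof -
  have "(\<lambda>n. exp (- (2 * pi * (1 / real (Suc n)) * norm \<xi>)\<^sup>2 / 2)) \<longlonglongrightarrow> exp (- (2 * pi * 0 * norm \<xi>)\<^sup>2 / 2)"
    by (intro tendsto_intros LIMSEQ_Suc[OF lim_const_over_n]) auto
  then show ?thesis
    by (simp add: damp_def)
qed

lemma damp_char:
  fixes w :: "'a::euclidean_space"
  assumes a: "a > 0"
  shows "(LINT \<xi>|lborel. complex_of_real (damp a \<xi>) * exp (2 * pi * \<i> * complex_of_real (w \<bullet> \<xi>))) =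
    complex_of_real (gauss ((1 / a) *\<^sub>R w) / a ^ DIM('a))"
proof -
  define c where "c = 2 * pi * a"
  have c: "c > 0"
    using a by (simp add: c_def)
  \<comment> \<open>One factor \<open>D\<close> arises since \<open>damp\<close> lacks the
    normalization of \<open>gauss\<close>, a second when the result is rewritten with
    \<open>gauss\<close>. Together they cancel the powers of 2 pi in the Jacobian
    \<open>\<bar>c\<bar> ^ DIM('a)\<close>, leaving only the power of \<open>a\<close>.\<close>
  define D where "D = sqrt (2 * pi) ^ DIM('a)"
  have D: "D > 0" "D * D = (2 * pi) ^ DIM('a)"
    unfolding D_def power_mult_distrib[symmetric] by simp_all
  let ?h = "\<lambda>x::'a. complex_of_real (gauss x) * exp (\<i> * complex_of_real (x \<bullet> ((1 / a) *\<^sub>R w)))"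
  have h: "?h (0 + c *\<^sub>R \<xi>) = 
      complex_of_real (damp a \<xi>) * exp (2 * pi * \<i> * complex_of_real (w \<bullet> \<xi>)) / D" for \<xi>
    using a D by (simp add: damp_eq_gauss c_def D_def inner_commute mult_ac)
  have "complex_of_real (exp (- (norm ((1 / a) *\<^sub>R w))\<^sup>2 / 2)) = (LINT x|lborel. ?h x)"
    by (rule gauss_char[symmetric])
  also have "\<dots> = \<bar>c\<bar> ^ DIM('a) *\<^sub>R (LINT \<xi>|lborel. ?h (0 + c *\<^sub>R \<xi>))"
    by (rule lborel_integral_affine) (use c in auto)
  also have "\<dots> = complex_of_real (\<bar>c\<bar> ^ DIM('a)) * (LINT \<xi>|lborel. complex_of_real (damp a \<xi>) * exp (2 * pi * \<i> * complex_of_real (w \<bullet> \<xi>))) / D"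
    unfolding h by (simp add: scaleR_conv_of_real)
  finally have *: "(LINT \<xi>|lborel. complex_of_real (damp a \<xi>) * exp (2 * pi * \<i> * complex_of_real (w \<bullet> \<xi>))) =
      complex_of_real (D * exp (- (norm ((1 / a) *\<^sub>R w))\<^sup>2 / 2) / \<bar>c\<bar> ^ DIM('a))"
    using D(1) c by simp
  have "\<bar>c\<bar> ^ DIM('a) = D * D * a ^ DIM('a)"
    using a by (simp add: D c_def power_mult_distrib abs_mult)
  then show ?thesis
    unfolding * using D(1) a by (simp add: gauss_eq D_def[symmetric])
qed

subsection \<open>Gaussian damping and the inequality of Bessel\<close>

text \<open>Values in [0, infinity] free the estimates from integrability conditions and admit
  Fatou's lemma; the square avoids roots, at the price of a triangle inequality with
  constants.\<close>

definition L2_sq :: "('a::euclidean_space \<Rightarrow> complex) \<Rightarrow> ennreal" where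
  "L2_sq f = (\<integral>\<^sup>+x. ennreal ((cmod (f x))\<^sup>2) \<partial>lborel)"

text \<open>Integrability is not assumed: the Bochner integral of a non-integrable function is 0,
  and the bound is then trivial.\<close>

lemma ennreal_norm_integral_le:
  fixes f :: "'a \<Rightarrow> 'b::{banach, second_countable_topology}"
  shows "ennreal (norm (LINT x|M. f x)) \<le> (\<integral>\<^sup>+x. ennreal (norm (f x)) \<partial>M)"
  by (cases "integrable M f") (auto simp: integral_norm_bound_ennreal not_integrable_integral_eq)

lemma fourier_measurable:
  assumes [measurable]: "f \<in> borel_measurable borel"
  shows "fourier f \<in> borel_measurable borel"
  unfolding fourier_def[abs_def] by measurable

lemma integrable_mult_unimodular:
  fixes f :: "'a::euclidean_space \<Rightarrow> complex"
  assumes f: "integrable lborel f" and [measurable]: "u \<in> borel_measurable borel"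
    and u: "\<And>x. cmod (u x) = 1"
  shows "integrable lborel (\<lambda>x. f x * u x)"
proof (rule Bochner_Integration.integrable_bound[OF f])
  have [measurable]: "f \<in> borel_measurable borel"
    using f by auto
  show "(\<lambda>x. f x * u x) \<in> borel_measurable lborel"
    by measurable
qed (auto simp: norm_mult u)

lemma cmod_exp_i [simp]: "cmod (exp (2 * complex_of_real pi * \<i> * complex_of_real t)) = 1"
  "cmod (exp (- (2 * complex_of_real pi * \<i> * complex_of_real t))) = 1"
  by (simp_all add: norm_exp_eq_Re)

lemma fourier_integrand:
  fixes f :: "'a::euclidean_space \<Rightarrow> complex"
  assumes f: "integrable lborel f"
  shows "integrable lborel (\<lambda>x. f x * exp (- 2 * pi * \<i> * complex_of_real (x \<bullet> \<xi>)))"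
  by (rule integrable_mult_unimodular[OF f]) auto

lemma fourier_bound:
  fixes f :: "'a::euclidean_space \<Rightarrow> complex"
  shows "cmod (fourier f \<xi>) \<le> (LINT x|lborel. cmod (f x))"
proof -
  have "cmod (fourier f \<xi>) \<le> (LINT x|lborel. cmod (f x * exp (- 2 * pi * \<i> * complex_of_real (x \<bullet> \<xi>))))"
    unfolding fourier_def by (rule integral_norm_bound)
  then show ?thesis
    by (simp add: norm_mult)
qed

lemma fourier_diff:
  fixes f g :: "'a::euclidean_space \<Rightarrow> complex"
  assumes "integrable lborel f" "integrable lborel g"
  shows "fourier (\<lambda>x. f x - g x) = (\<lambda>\<xi>. fourier f \<xi> - fourier g \<xi>)"
proof
  fix \<xi>
  show "fourier (\<lambda>x. f x - g x) \<xi> = fourier f \<xi> - fourier g \<xi>"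
    using Bochner_Integration.integral_diff[OF fourier_integrand[OF assms(1)] fourier_integrand[OF assms(2)], of \<xi> \<xi>]
    by (simp add: fourier_def left_diff_distrib)
qed

text \<open>This is convolution with the Gaussian at scale \<open>a\<close>, after the substitution
  y = x - a z. The weight no longer depends on \<open>a\<close>, so one dominating function serves
  the whole limit as \<open>a\<close> tends to 0.\<close>

definition mollify :: "real \<Rightarrow> ('a::euclidean_space \<Rightarrow> complex) \<Rightarrow> 'a \<Rightarrow> complex" where
  "mollify a f x = (LINT z|lborel. f (x - a *\<^sub>R z) * complex_of_real (gauss z))"

lemma mollify_measurable:
  assumes [measurable]: "f \<in> borel_measurable borel"
  shows "mollify a f \<in> borel_measurable borel"
  unfolding mollify_def[abs_def] by measurable

text \<open>This supplies absolute convergence for both exchanges of integrals below, where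
  \<open>u\<close> is the unimodular Fourier kernel.\<close>

lemma integrable_mult_pair:
  fixes f :: "'a::euclidean_space \<Rightarrow> complex" and g :: "'b::euclidean_space \<Rightarrow> complex"
  assumes f: "integrable lborel f" and g: "integrable lborel g"
    and [measurable]: "(\<lambda>(x, y). u x y) \<in> borel_measurable (borel \<Otimes>\<^sub>M borel)"
    and u: "\<And>x y. cmod (u x y) \<le> M"
  shows "integrable (lborel \<Otimes>\<^sub>M lborel) (\<lambda>(x, y). f x * g y * u x y)"
proof -
  have [measurable]: "f \<in> borel_measurable borel" "g \<in> borel_measurable borel"
    using f g by auto
  have fg: "integrable (lborel \<Otimes>\<^sub>M lborel) (\<lambda>p. f (fst p) * g (snd p))"
  proof (rule lborel_pair.Fubini_integrable)
    show "integrable lborel (\<lambda>x. LINT y|lborel. norm (f (fst (x, y)) * g (snd (x, y))))"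
      using f by (simp add: norm_mult)
    show "AE x in lborel. integrable lborel (\<lambda>y. f (fst (x, y)) * g (snd (x, y)))"
      using g by simp
  qed simp
  show ?thesis
  proof (rule Bochner_Integration.integrable_bound[OF integrable_mult_right[OF fg, of "complex_of_real M"]])
    show "(\<lambda>(x, y). f x * g y * u x y) \<in> borel_measurable (lborel \<Otimes>\<^sub>M lborel)"
      by measurable
    have "cmod (f x) * cmod (g y) * cmod (u x y) \<le> \<bar>M\<bar> * (cmod (f x) * cmod (g y))" for x y
      using mult_left_mono[OF order_trans[OF u abs_ge_self], of "cmod (f x) * cmod (g y)" x y]
      by (simp add: mult_ac)
    then show "AE p in lborel \<Otimes>\<^sub>M lborel. norm (case p of (x, y) \<Rightarrow> f x * g y * u x y)
        \<le> norm (complex_of_real M * (f (fst p) * g (snd p)))"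
      by (intro AE_I2) (auto simp: norm_mult)
  qed
qed

text \<open>Undamped inversion need not converge absolutely. With \<open>damp\<close> inserted
  Fubini applies, and by \<open>damp_char\<close> the frequency integral becomes the Gaussian
  kernel; its factor a^(-n) is the Jacobian of y = x - a z.\<close>

lemma mollify_eq_fourier_inversion:
  fixes f :: "'a::euclidean_space \<Rightarrow> complex"
  assumes f: "integrable lborel f" and a: "a > 0"
  shows "mollify a f x = (LINT \<xi>|lborel. fourier f \<xi> * complex_of_real (damp a \<xi>) *
      exp (2 * pi * \<i> * complex_of_real (x \<bullet> \<xi>)))"
proof -
  have [measurable]: "f \<in> borel_measurable borel"
    using f by auto
  let ?u = "\<lambda>\<xi> y. exp (2 * complex_of_real pi * \<i> * complex_of_real ((x - y) \<bullet> \<xi>))"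
  have "integrable (lborel \<Otimes>\<^sub>M lborel) (\<lambda>(\<xi>, y). complex_of_real (damp a \<xi>) * f y * ?u \<xi> y)"
    by (rule integrable_mult_pair[where M = 1]) (use f damp_integrable[OF a] in auto)
  note Fub = lborel_pair.Fubini_integral[OF this]
  have "mollify a f x = (LINT y|lborel. f y * complex_of_real (gauss ((1 / a) *\<^sub>R (x - y)) / a ^ DIM('a)))"
    using a by (subst lborel_integral_affine[where c = "- a" and t = x])
      (auto simp: mollify_def scaleR_conv_of_real)
  also have "\<dots> = (LINT y|lborel. LINT \<xi>|lborel. complex_of_real (damp a \<xi>) * f y * ?u \<xi> y)"
  proof (rule Bochner_Integration.integral_cong[OF refl])
    fix y
    show "f y * complex_of_real (gauss ((1 / a) *\<^sub>R (x - y)) / a ^ DIM('a)) =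
        (LINT \<xi>|lborel. complex_of_real (damp a \<xi>) * f y * ?u \<xi> y)"
      unfolding damp_char[OF a, symmetric]
      by (simp flip: integral_mult_right_zero add: mult_ac)
  qed
  also have "\<dots> = (LINT \<xi>|lborel. LINT y|lborel. complex_of_real (damp a \<xi>) * f y * ?u \<xi> y)"
    by (rule Fub)
  also have "\<dots> = (LINT \<xi>|lborel. fourier f \<xi> * complex_of_real (damp a \<xi>) *
      exp (2 * pi * \<i> * complex_of_real (x \<bullet> \<xi>)))"
  proof (rule Bochner_Integration.integral_cong[OF refl])
    fix \<xi>
    have "complex_of_real (damp a \<xi>) * f y * ?u \<xi> y =
        (complex_of_real (damp a \<xi>) * exp (2 * pi * \<i> * complex_of_real (x \<bullet> \<xi>))) *
        (f y * exp (- 2 * pi * \<i> * complex_of_real (y \<bullet> \<xi>)))" for y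
      by (simp add: inner_diff_left ring_distribs exp_diff exp_minus divide_inverse)
    then show "(LINT y|lborel. complex_of_real (damp a \<xi>) * f y * ?u \<xi> y) =
        fourier f \<xi> * complex_of_real (damp a \<xi>) * exp (2 * pi * \<i> * complex_of_real (x \<bullet> \<xi>))"
      by (simp only: integral_mult_right_zero) (simp only: fourier_def mult_ac)
  qed
  finally show ?thesis .
qed

lemma integrable_fourier_damp:
  fixes f :: "'a::euclidean_space \<Rightarrow> complex"
  assumes f: "integrable lborel f" and a: "a > 0"
  shows "integrable lborel (\<lambda>\<xi>. fourier f \<xi> * complex_of_real (damp a \<xi>))"
proof (rule Bochner_Integration.integrable_bound[OF integrable_mult_right[OF damp_integrable[OF a], of "LINT x|lborel. cmod (f x)"]])
  have "f \<in> borel_measurable borel"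
    using f by auto
  note [measurable] = fourier_measurable[OF this]
  show "(\<lambda>\<xi>. fourier f \<xi> * complex_of_real (damp a \<xi>)) \<in> borel_measurable lborel"
    by measurable
  show "AE \<xi> in lborel. norm (fourier f \<xi> * complex_of_real (damp a \<xi>)) \<le>
      norm ((LINT x|lborel. cmod (f x)) * damp a \<xi>)"
    by (intro AE_I2) (auto simp: norm_mult abs_mult intro!: mult_right_mono fourier_bound order_trans[OF fourier_bound abs_ge_self])
qed

text \<open>Inserting the damped inversion formula and exchanging the integrals leaves the conjugate
  of \<open>fourier f\<close> as the inner integral.\<close>

lemma mollify_pairing:
  fixes f :: "'a::euclidean_space \<Rightarrow> complex"
  assumes f: "integrable lborel f" and a: "a > 0"
  shows "(LINT x|lborel. mollify a f x * cnj (f x)) =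
     complex_of_real (LINT \<xi>|lborel. (cmod (fourier f \<xi>))\<^sup>2 * damp a \<xi>)"
proof -
  have [measurable]: "f \<in> borel_measurable borel"
    using f by auto
  let ?F = "\<lambda>\<xi>. fourier f \<xi> * complex_of_real (damp a \<xi>)"
  let ?e = "\<lambda>\<xi> x. exp (2 * complex_of_real pi * \<i> * complex_of_real (x \<bullet> \<xi>))"
  have "integrable (lborel \<Otimes>\<^sub>M lborel) (\<lambda>(\<xi>, x). ?F \<xi> * cnj (f x) * ?e \<xi> x)"
    by (rule integrable_mult_pair[where M = 1]) (use f integrable_fourier_damp[OF f a] in auto)
  note Fub = lborel_pair.Fubini_integral[OF this]
  have "(LINT x|lborel. mollify a f x * cnj (f x)) =
      (LINT x|lborel. LINT \<xi>|lborel. ?F \<xi> * cnj (f x) * ?e \<xi> x)"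
    by (intro Bochner_Integration.integral_cong[OF refl])
      (simp add: mollify_eq_fourier_inversion[OF f a] mult_ac flip: integral_mult_right_zero)
  also have "\<dots> = (LINT \<xi>|lborel. LINT x|lborel. ?F \<xi> * cnj (f x) * ?e \<xi> x)"
    by (rule Fub)
  also have "\<dots> = (LINT \<xi>|lborel. complex_of_real ((cmod (fourier f \<xi>))\<^sup>2 * damp a \<xi>))"
  proof (rule Bochner_Integration.integral_cong[OF refl])
    fix \<xi>
    have "cnj (fourier f \<xi>) = (LINT x|lborel. cnj (f x) * ?e \<xi> x)"
      unfolding fourier_def
      by (subst Bochner_Integration.integral_cnj[symmetric]) (simp add: exp_cnj)
    then have "(LINT x|lborel. ?F \<xi> * cnj (f x) * ?e \<xi> x) = ?F \<xi> * cnj (fourier f \<xi>)"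
      by (simp add: mult.assoc)
    also have "\<dots> = complex_of_real ((cmod (fourier f \<xi>))\<^sup>2 * damp a \<xi>)"
      by (simp only: of_real_mult complex_norm_square mult_ac)
    finally show "(LINT x|lborel. ?F \<xi> * cnj (f x) * ?e \<xi> x) =
        complex_of_real ((cmod (fourier f \<xi>))\<^sup>2 * damp a \<xi>)" .
  qed
  also have "\<dots> = complex_of_real (LINT \<xi>|lborel. (cmod (fourier f \<xi>))\<^sup>2 * damp a \<xi>)"
    by (rule integral_complex_of_real)
  finally show ?thesis .
qed

text \<open>Under the Gaussian, the product of the moduli of f(x - a z) and f(x) is at most half the
  sum of their squares. By translation invariance each square integrates to \<open>L2_sq f\<close>,
  and the Gaussian has mass 1.\<close>

lemma mollify_pairing_le:
  fixes f :: "'a::euclidean_space \<Rightarrow> complex"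
  assumes [measurable]: "f \<in> borel_measurable borel"
  shows "(\<integral>\<^sup>+x. ennreal (cmod (mollify a f x * cnj (f x))) \<partial>lborel) \<le> L2_sq f"
proof -
  let ?k = "\<lambda>x z. (ennreal ((cmod (f (x - a *\<^sub>R z)))\<^sup>2) + ennreal ((cmod (f x))\<^sup>2)) * ennreal (gauss z / 2)"
  have "ennreal (cmod (mollify a f x * cnj (f x))) \<le> (\<integral>\<^sup>+z. ?k x z \<partial>lborel)" for x
  proof -
    have "mollify a f x * cnj (f x) = (LINT z|lborel. f (x - a *\<^sub>R z) * complex_of_real (gauss z) * cnj (f x))"
      by (simp add: mollify_def)
    also have "ennreal (cmod \<dots>) \<le> (\<integral>\<^sup>+z. ennreal (cmod (f (x - a *\<^sub>R z) * complex_of_real (gauss z) * cnj (f x))) \<partial>lborel)"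
      by (rule ennreal_norm_integral_le)
    also have "\<dots> \<le> (\<integral>\<^sup>+z. ?k x z \<partial>lborel)"
    proof (rule nn_integral_mono)
      fix z
      let ?p = "cmod (f (x - a *\<^sub>R z))" and ?q = "cmod (f x)"
      have "?p * ?q \<le> (?p\<^sup>2 + ?q\<^sup>2) / 2"
        using sum_squares_bound[of ?p ?q] by simp
      then have "?p * ?q * gauss z \<le> (?p\<^sup>2 + ?q\<^sup>2) / 2 * gauss z"
        by (intro mult_right_mono) auto
      then have "ennreal (cmod (f (x - a *\<^sub>R z) * complex_of_real (gauss z) * cnj (f x)))
         \<le> ennreal ((?p\<^sup>2 + ?q\<^sup>2) * (gauss z / 2))"
        by (intro ennreal_leI) (simp add: norm_mult mult_ac)
      also have "\<dots> = ?k x z"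
        by (simp flip: ennreal_plus ennreal_mult)
      finally show "ennreal (cmod (f (x - a *\<^sub>R z) * complex_of_real (gauss z) * cnj (f x))) \<le> ?k x z" .
    qed
    finally show ?thesis .
  qed
  then have "(\<integral>\<^sup>+x. ennreal (cmod (mollify a f x * cnj (f x))) \<partial>lborel) \<le> (\<integral>\<^sup>+x. \<integral>\<^sup>+z. ?k x z \<partial>lborel \<partial>lborel)"
    by (intro nn_integral_mono)
  also have "\<dots> = (\<integral>\<^sup>+z. \<integral>\<^sup>+x. ?k x z \<partial>lborel \<partial>lborel)"
    by (rule lborel_pair.Fubini'[symmetric]) measurable
  also have "\<dots> = (\<integral>\<^sup>+z. L2_sq f * ennreal (gauss (z::'a)) \<partial>lborel)"
  proof (rule nn_integral_cong)
    fix z :: 'a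
    have "(\<integral>\<^sup>+x. ?k x z \<partial>lborel) = (L2_sq f + L2_sq f) * ennreal (gauss z / 2)"
      by (simp add: nn_integral_multc nn_integral_add L2_sq_def
          nn_integral_lborel_translate[of "\<lambda>x. ennreal ((cmod (f x))\<^sup>2)"])
    also have "\<dots> = L2_sq f * ennreal (gauss z)"
      by (simp add: distrib_right flip: distrib_left ennreal_plus)
    finally show "(\<integral>\<^sup>+x. ?k x z \<partial>lborel) = L2_sq f * ennreal (gauss z)" .
  qed
  also have "\<dots> = L2_sq f"
    by (simp add: nn_integral_cmult nn_integral_eq_integral gauss_integral)
  finally show ?thesis .
qed

lemma bessel_damp:
  fixes f :: "'a::euclidean_space \<Rightarrow> complex"
  assumes f: "integrable lborel f" and a: "a > 0"
  shows "(\<integral>\<^sup>+\<xi>. ennreal ((cmod (fourier f \<xi>))\<^sup>2 * damp a \<xi>) \<partial>lborel) \<le> L2_sq f"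
proof -
  have [measurable]: "f \<in> borel_measurable borel"
    using f by auto
  note [measurable] = fourier_measurable[OF this]
  let ?M = "LINT x|lborel. cmod (f x)"
  have "integrable lborel (\<lambda>\<xi>. (cmod (fourier f \<xi>))\<^sup>2 * damp a \<xi>)"
  proof (rule Bochner_Integration.integrable_bound[OF integrable_mult_right[OF damp_integrable[OF a], of "?M\<^sup>2"]])
    show "AE \<xi> in lborel. norm ((cmod (fourier f \<xi>))\<^sup>2 * damp a \<xi>) \<le> norm (?M\<^sup>2 * damp a \<xi>)"
      by (intro AE_I2) (auto simp: abs_mult intro!: mult_right_mono power_mono fourier_bound)
  qed measurable
  then have "(\<integral>\<^sup>+\<xi>. ennreal ((cmod (fourier f \<xi>))\<^sup>2 * damp a \<xi>) \<partial>lborel) =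
      ennreal (LINT \<xi>|lborel. (cmod (fourier f \<xi>))\<^sup>2 * damp a \<xi>)"
    by (intro nn_integral_eq_integral) auto
  also have "\<dots> = ennreal (cmod (LINT x|lborel. mollify a f x * cnj (f x)))"
    by (simp add: mollify_pairing[OF f a] integral_nonneg_AE)
  also have "\<dots> \<le> (\<integral>\<^sup>+x. ennreal (cmod (mollify a f x * cnj (f x))) \<partial>lborel)"
    by (rule ennreal_norm_integral_le)
  also have "\<dots> \<le> L2_sq f"
    by (rule mollify_pairing_le) simp
  finally show ?thesis .
qed

text \<open>Fatou's lemma removes the damping along the scales 1/(n+1). The function need not be
  square integrable; the right side may be infinite.\<close>

lemma bessel:
  fixes f :: "'a::euclidean_space \<Rightarrow> complex"
  assumes f: "integrable lborel f"
  shows "L2_sq (fourier f) \<le> L2_sq f"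
proof -
  have [measurable]: "f \<in> borel_measurable borel"
    using f by auto
  note [measurable] = fourier_measurable[OF this]
  let ?s = "\<lambda>n \<xi>. ennreal ((cmod (fourier f \<xi>))\<^sup>2 * damp (1 / real (Suc n)) \<xi>)"
  have lim: "(\<lambda>n. ?s n \<xi>) \<longlonglongrightarrow> ennreal ((cmod (fourier f \<xi>))\<^sup>2)" for \<xi>
    using tendsto_mult[OF tendsto_const damp_tendsto_1, of "(cmod (fourier f \<xi>))\<^sup>2" \<xi>]
    by (intro tendsto_ennrealI) simp
  have "L2_sq (fourier f) = (\<integral>\<^sup>+\<xi>. liminf (\<lambda>n. ?s n \<xi>) \<partial>lborel)"
    unfolding L2_sq_def by (intro nn_integral_cong lim_imp_Liminf[symmetric] lim) auto
  also have "\<dots> \<le> liminf (\<lambda>n. \<integral>\<^sup>+\<xi>. ?s n \<xi> \<partial>lborel)"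
    by (rule nn_integral_liminf) measurable
  also have "\<dots> \<le> L2_sq f"
    by (intro Liminf_le always_eventually allI bessel_damp f) auto
  finally show ?thesis .
qed

subsection \<open>Plancherel's theorem for integrable functions\<close>

lemma cnj_measurable [measurable]: "cnj \<in> borel_measurable borel"
  by (intro borel_measurable_continuous_onI continuous_intros)

lemma L2_space_iff:
  "f \<in> L2_space \<longleftrightarrow> f \<in> borel_measurable borel \<and> L2_sq f < \<infinity>"
proof -
  have "integrable lborel (\<lambda>x. (cmod (f x))\<^sup>2) \<longleftrightarrow> L2_sq f < \<infinity>" if "f \<in> borel_measurable borel"
    using that by (auto simp: integrable_iff_bounded L2_sq_def)
  then show ?thesis
    by (auto simp: L2_space_def)
qed

lemma L2_tendsto_iff: "L2_tendsto fs f \<longleftrightarrow> (\<lambda>k. L2_sq (\<lambda>x. fs k x - f x)) \<longlonglongrightarrow> 0"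
  by (simp add: L2_tendsto_def L2_sq_def)

section \<open>Calculus of squared norms with values in [0, infinity]\<close>

lemma L2_sq_cong_AE: "(AE x in lborel. f x = g x) \<Longrightarrow> L2_sq f = L2_sq g"
  unfolding L2_sq_def by (rule nn_integral_cong_AE) auto

lemma L2_sq_commute: "L2_sq (\<lambda>x. f x - g x) = L2_sq (\<lambda>x. g x - f x)"
  by (simp add: L2_sq_def norm_minus_commute)

lemma L2_sq_cnj: "L2_sq (\<lambda>x. cnj (f x)) = L2_sq f"
  by (simp add: L2_sq_def)

text \<open>The mixed term of the square of a sum is absorbed by the nonnegative quantity (eta a -
  b)^2 / eta. With \<open>\<eta>\<close> = 1 this is a crude triangle inequality; small
  \<open>\<eta>\<close> brings the factor of the main term close to 1, which limits of norms
  require.\<close>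

lemma L2_sq_le_peter_paul:
  assumes [measurable]: "f \<in> borel_measurable borel" "g \<in> borel_measurable borel" and \<eta>: "\<eta> > 0"
  shows "L2_sq f \<le> ennreal (1 + \<eta>) * L2_sq g + ennreal (1 + 1 / \<eta>) * L2_sq (\<lambda>x. f x - g x)"
proof -
  have *: "(cmod (f x))\<^sup>2 \<le> (1 + \<eta>) * (cmod (g x))\<^sup>2 + (1 + 1 / \<eta>) * (cmod (f x - g x))\<^sup>2" for x
  proof -
    let ?a = "cmod (g x)" and ?b = "cmod (f x - g x)"
    have "(cmod (f x))\<^sup>2 \<le> (?a + ?b)\<^sup>2"
      using norm_triangle_ineq[of "g x" "f x - g x"] by (intro power_mono) auto
    also have "\<dots> \<le> (1 + \<eta>) * ?a\<^sup>2 + (1 + 1 / \<eta>) * ?b\<^sup>2"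
    proof -
      have "0 \<le> (\<eta> * ?a - ?b)\<^sup>2 / \<eta>"
        using \<eta> by simp
      also have "\<dots> = \<eta> * ?a\<^sup>2 + ?b\<^sup>2 / \<eta> - 2 * ?a * ?b"
        using \<eta> by (simp add: power2_diff power_mult_distrib field_simps) (simp add: power2_eq_square)
      finally show ?thesis
        by (simp add: power2_sum algebra_simps)
    qed
    finally show ?thesis .
  qed
  have "L2_sq f \<le> (\<integral>\<^sup>+x. ennreal (1 + \<eta>) * ennreal ((cmod (g x))\<^sup>2) +
      ennreal (1 + 1 / \<eta>) * ennreal ((cmod (f x - g x))\<^sup>2) \<partial>lborel)"
    unfolding L2_sq_def
  proof (rule nn_integral_mono)
    fix x
    have "ennreal ((cmod (f x))\<^sup>2) \<le> ennreal ((1 + \<eta>) * (cmod (g x))\<^sup>2 + (1 + 1 / \<eta>) * (cmod (f x - g x))\<^sup>2)"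
      by (intro ennreal_leI *)
    also have "\<dots> = ennreal (1 + \<eta>) * ennreal ((cmod (g x))\<^sup>2) +
      ennreal (1 + 1 / \<eta>) * ennreal ((cmod (f x - g x))\<^sup>2)"
      using \<eta> by (simp add: ennreal_plus ennreal_mult del: ennreal_plus[symmetric])
    finally show "ennreal ((cmod (f x))\<^sup>2) \<le> ennreal (1 + \<eta>) * ennreal ((cmod (g x))\<^sup>2) +
      ennreal (1 + 1 / \<eta>) * ennreal ((cmod (f x - g x))\<^sup>2)" .
  qed
  also have "\<dots> = ennreal (1 + \<eta>) * L2_sq g + ennreal (1 + 1 / \<eta>) * L2_sq (\<lambda>x. f x - g x)"
    by (simp add: L2_sq_def nn_integral_add nn_integral_cmult)
  finally show ?thesis .
qed

lemma L2_sq_diff_le: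
  assumes [measurable]: "f \<in> borel_measurable borel" "g \<in> borel_measurable borel" "h \<in> borel_measurable borel"
  shows "L2_sq (\<lambda>x. f x - h x) \<le> 2 * L2_sq (\<lambda>x. f x - g x) + 2 * L2_sq (\<lambda>x. g x - h x)"
  using L2_sq_le_peter_paul[of "\<lambda>x. f x - h x" "\<lambda>x. f x - g x" 1]
  by simp

text \<open>The preceding estimate is used once for \<open>f\<close> and once for \<open>F\<close>.
  The error terms vanish as k grows at fixed \<open>\<eta>\<close>; afterwards \<open>\<eta>\<close>
  = 1/(n+1) tends to 0, and no constant is lost.\<close>

lemma L2_sq_le_limit:
  assumes [measurable]: "f \<in> borel_measurable borel" "F \<in> borel_measurable borel"
    "\<And>k. fs k \<in> borel_measurable borel" "\<And>k. Fs k \<in> borel_measurable borel"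
    and f: "L2_tendsto fs f" and F: "L2_tendsto Fs F"
    and le: "\<And>k. L2_sq (fs k) \<le> L2_sq (Fs k)"
  shows "L2_sq f \<le> L2_sq F"
proof -
  have *: "L2_sq f \<le> ennreal ((1 + \<eta>) * (1 + \<eta>)) * L2_sq F" if \<eta>: "\<eta> > 0" for \<eta> :: real
  proof -
    let ?A = "ennreal (1 + \<eta>)" and ?B = "ennreal (1 + 1 / \<eta>)"
    let ?r = "\<lambda>k. ?A * (?A * L2_sq F + ?B * L2_sq (\<lambda>x. Fs k x - F x)) + ?B * L2_sq (\<lambda>x. fs k x - f x)"
    have "?r \<longlonglongrightarrow> ?A * (?A * L2_sq F + ?B * 0) + ?B * 0"
      using f F by (intro tendsto_add ennreal_tendsto_cmult tendsto_const) (auto simp: L2_tendsto_iff)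
    moreover have "L2_sq f \<le> ?r k" for k
    proof -
      have "L2_sq f \<le> ?A * L2_sq (fs k) + ?B * L2_sq (\<lambda>x. f x - fs k x)"
        by (rule L2_sq_le_peter_paul[OF _ _ \<eta>]) measurable
      also have "\<dots> \<le> ?A * L2_sq (Fs k) + ?B * L2_sq (\<lambda>x. fs k x - f x)"
        unfolding L2_sq_commute[of f] by (intro add_mono mult_left_mono le) auto
      also have "\<dots> \<le> ?r k"
        by (intro add_mono mult_left_mono order_refl L2_sq_le_peter_paul[OF _ _ \<eta>]) auto
      finally show ?thesis .
    qed
    ultimately have "L2_sq f \<le> ?A * (?A * L2_sq F + ?B * 0) + ?B * 0"
      by (intro LIMSEQ_le_const) auto
    then show ?thesis
      using \<eta> by (simp add: ennreal_mult mult.assoc)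
  qed
  have lim: "(\<lambda>n. (1 + 1 / real (Suc n)) * (1 + 1 / real (Suc n))) \<longlonglongrightarrow> (1 + 0) * (1 + 0)"
    by (intro tendsto_intros LIMSEQ_Suc[OF lim_const_over_n])
  show ?thesis
  proof (cases "L2_sq F = \<infinity>")
    case False
    then obtain c where c: "L2_sq F = ennreal c" "c \<ge> 0"
      by (cases "L2_sq F") auto
    have "L2_sq f \<le> ennreal ((1 + 1 / real (Suc n)) * (1 + 1 / real (Suc n)) * c)" for n
      using *[of "1 / real (Suc n)"] c by (simp add: ennreal_mult)
    moreover have "(\<lambda>n. ennreal ((1 + 1 / real (Suc n)) * (1 + 1 / real (Suc n)) * c)) \<longlonglongrightarrow> ennreal ((1 + 0) * (1 + 0) * c)"
      by (intro tendsto_ennrealI tendsto_mult_right lim)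
    ultimately have "L2_sq f \<le> ennreal ((1 + 0) * (1 + 0) * c)"
      by (intro LIMSEQ_le_const) auto
    then show ?thesis
      by (simp add: c)
  qed simp
qed

text \<open>Continuity and boundedness give pointwise convergence of mollifications with a uniform
  bound; integrability makes the Fourier integral converge and provides a dominating function for
  the pairing.\<close>

definition bcont_L1 :: "('a::euclidean_space \<Rightarrow> complex) \<Rightarrow> bool" where
  "bcont_L1 h \<longleftrightarrow> continuous_on UNIV h \<and> bounded (range h) \<and> integrable lborel h"

lemma bcont_L1_bound:
  assumes "bcont_L1 h"
  obtains M where "M > 0" "\<And>x. cmod (h x) \<le> M"
  using assms bounded_pos[of "range h"] by (auto simp: bcont_L1_def)

lemma bcont_L1_measurable: "bcont_L1 h \<Longrightarrow> h \<in> borel_measurable borel"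
  by (auto simp: bcont_L1_def)

lemma bcont_L1_integrable: "bcont_L1 h \<Longrightarrow> integrable lborel h"
  by (auto simp: bcont_L1_def)

lemma bcont_L1_square_integrable: 
  assumes "bcont_L1 h" shows "integrable lborel (\<lambda>x. (cmod (h x))\<^sup>2)"
proof -
  obtain M where M: "M > 0" "\<And>x. cmod (h x) \<le> M"
    using bcont_L1_bound[OF assms] by blast
  note [measurable] = bcont_L1_measurable[OF assms]
  show ?thesis
  proof (rule Bochner_Integration.integrable_bound[OF integrable_mult_right[OF integrable_norm[OF bcont_L1_integrable[OF assms]], of M]])
    show "AE x in lborel. norm ((cmod (h x))\<^sup>2) \<le> norm (M * cmod (h x))"
      using M by (intro AE_I2) (auto simp: power2_eq_square abs_mult intro!: mult_right_mono)
  qed measurable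
qed

lemma bcont_L1_L2:
  assumes "bcont_L1 h" shows "h \<in> L2_space" 
  using bcont_L1_square_integrable[OF assms] bcont_L1_measurable[OF assms] by (auto simp: L2_space_def)

lemma bcont_L1_L2_sq:
  assumes "bcont_L1 h" shows "L2_sq h = ennreal (LINT x|lborel. (cmod (h x))\<^sup>2)" 
  using bcont_L1_square_integrable[OF assms] by (auto simp: L2_sq_def nn_integral_eq_integral)

lemma mollify_bound:
  fixes h :: "'a::euclidean_space \<Rightarrow> complex"
  assumes h: "bcont_L1 h" and M: "\<And>x. cmod (h x) \<le> M"
  shows "cmod (mollify a h x) \<le> M"
proof -
  note [measurable] = bcont_L1_measurable[OF h]
  have "cmod (mollify a h x) \<le> (LINT z|lborel. M * gauss (z::'a))"
    unfolding mollify_def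
  proof (rule Bochner_Integration.integral_norm_bound_integral)
    show "integrable lborel (\<lambda>z. h (x - a *\<^sub>R z) * complex_of_real (gauss z))"
      by (rule Bochner_Integration.integrable_bound[where f = "\<lambda>z. M * gauss z"])
        (auto simp: norm_mult intro!: AE_I2 order_trans[OF mult_right_mono[OF M gauss_nonneg] abs_ge_self])
  qed (auto simp: norm_mult intro!: mult_right_mono M)
  then show ?thesis
    by (simp add: gauss_integral)
qed

lemma mollify_tendsto:
  fixes h :: "'a::euclidean_space \<Rightarrow> complex"
  assumes h: "bcont_L1 h"
  shows "(\<lambda>n. mollify (1 / real (Suc n)) h x) \<longlonglongrightarrow> h x"
proof -
  note [measurable] = bcont_L1_measurable[OF h]
  obtain M where M: "M > 0" "\<And>x. cmod (h x) \<le> M"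
    using bcont_L1_bound[OF h] by blast
  have "(\<lambda>n. mollify (1 / real (Suc n)) h x) \<longlonglongrightarrow> (LINT z|lborel. h x * complex_of_real (gauss (z::'a)))"
    unfolding mollify_def
  proof (rule integral_dominated_convergence[where w = "\<lambda>z. M * gauss z"])
    have cont: "isCont h x"
      using h by (auto simp: bcont_L1_def continuous_on_eq_continuous_at)
    have "(\<lambda>n. x - (1 / real (Suc n)) *\<^sub>R z) \<longlonglongrightarrow> x - 0 *\<^sub>R z" for z
      by (intro tendsto_intros LIMSEQ_Suc[OF lim_const_over_n])
    then show "AE z in lborel. (\<lambda>n. h (x - (1 / real (Suc n)) *\<^sub>R z) * complex_of_real (gauss z))
       \<longlonglongrightarrow> h x * complex_of_real (gauss z)"
      by (intro AE_I2 tendsto_mult tendsto_const isCont_tendsto_compose[OF cont]) simp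
  qed (use M in \<open>auto simp: norm_mult intro!: mult_right_mono\<close>)
  then show ?thesis
    by (simp add: gauss_integral)
qed

text \<open>If \<open>M\<close> bounds the modulus of \<open>h\<close>, it also bounds all
  mollifications, so \<open>M\<close> times the modulus of \<open>h\<close> dominates.\<close>

lemma mollify_pairing_tendsto:
  fixes h :: "'a::euclidean_space \<Rightarrow> complex"
  assumes h: "bcont_L1 h"
  shows "(\<lambda>n. LINT x|lborel. mollify (1 / real (Suc n)) h x * cnj (h x))
    \<longlonglongrightarrow> complex_of_real (LINT x|lborel. (cmod (h x))\<^sup>2)"
    and "integrable lborel (\<lambda>x. mollify (1 / real (Suc n)) h x * cnj (h x))"
proof -
  note [measurable] = bcont_L1_measurable[OF h] mollify_measurable[OF bcont_L1_measurable[OF h]]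
  obtain M where M: "M > 0" "\<And>x. cmod (h x) \<le> M"
    using bcont_L1_bound[OF h] by blast
  have *: "integrable lborel (\<lambda>x. M * cmod (h x))"
    using bcont_L1_integrable[OF h] by simp
  have lim: "AE x in lborel. (\<lambda>n. mollify (1 / real (Suc n)) h x * cnj (h x)) \<longlonglongrightarrow> h x * cnj (h x)"
    by (intro AE_I2 tendsto_mult tendsto_const mollify_tendsto h)
  have bd: "AE x in lborel. norm (mollify (1 / real (Suc n)) h x * cnj (h x)) \<le> M * cmod (h x)" for n
    by (intro AE_I2) (auto simp: norm_mult intro!: mult_right_mono mollify_bound[OF h] M)
  show "integrable lborel (\<lambda>x. mollify (1 / real (Suc n)) h x * cnj (h x))"
    by (rule integrable_dominated_convergence2[OF _ _ * lim bd]) measurable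
  have "(\<lambda>n. LINT x|lborel. mollify (1 / real (Suc n)) h x * cnj (h x))
    \<longlonglongrightarrow> (LINT x|lborel. h x * cnj (h x))"
    by (rule integral_dominated_convergence[OF _ _ * lim bd]) measurable
  also have "(LINT x|lborel. h x * cnj (h x)) = complex_of_real (LINT x|lborel. (cmod (h x))\<^sup>2)"
    by (simp only: complex_norm_square[symmetric] integral_complex_of_real)
  finally show "(\<lambda>n. LINT x|lborel. mollify (1 / real (Suc n)) h x * cnj (h x))
    \<longlonglongrightarrow> complex_of_real (LINT x|lborel. (cmod (h x))\<^sup>2)" .
qed

text \<open>The pairings tend to the square norm of \<open>h\<close>, while each is a damped
  integral and hence at most \<open>L2_sq (fourier h)\<close>, because \<open>damp\<close> is at
  most 1.\<close>

lemma bcont_L1_plancherel: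
  assumes h: "bcont_L1 h"
  shows "L2_sq h \<le> L2_sq (fourier h)"
proof -
  note [measurable] = bcont_L1_measurable[OF h] fourier_measurable[OF bcont_L1_measurable[OF h]]
  have "(\<lambda>n. ennreal (cmod (LINT x|lborel. mollify (1 / real (Suc n)) h x * cnj (h x))))
    \<longlonglongrightarrow> ennreal (cmod (complex_of_real (LINT x|lborel. (cmod (h x))\<^sup>2)))"
    by (intro tendsto_ennrealI tendsto_norm mollify_pairing_tendsto h)
  moreover have "ennreal (cmod (LINT x|lborel. mollify (1 / real (Suc n)) h x * cnj (h x))) \<le> L2_sq (fourier h)" for n
  proof -
    have "ennreal (cmod (LINT x|lborel. mollify (1 / real (Suc n)) h x * cnj (h x))) =
       ennreal (norm (LINT \<xi>|lborel. (cmod (fourier h \<xi>))\<^sup>2 * damp (1 / real (Suc n)) \<xi>))"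
      by (subst mollify_pairing[OF bcont_L1_integrable[OF h]]) auto
    also have "\<dots> \<le> (\<integral>\<^sup>+\<xi>. ennreal (norm ((cmod (fourier h \<xi>))\<^sup>2 * damp (1 / real (Suc n)) \<xi>)) \<partial>lborel)"
      by (rule ennreal_norm_integral_le)
    also have "\<dots> \<le> L2_sq (fourier h)"
      unfolding L2_sq_def by (intro nn_integral_mono ennreal_leI) (auto simp: abs_mult intro!: mult_left_le)
    finally show ?thesis .
  qed
  ultimately have "ennreal (cmod (complex_of_real (LINT x|lborel. (cmod (h x))\<^sup>2))) \<le> L2_sq (fourier h)"
    using LIMSEQ_le_const2 by blast
  then show ?thesis
    by (simp add: bcont_L1_L2_sq[OF h])
qed

section \<open>Density of bounded continuous integrable functions\<close>

definition clamp_norm :: "real \<Rightarrow> complex \<Rightarrow> complex" where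
  "clamp_norm r z = z /\<^sub>R max 1 (cmod z / r)"

text \<open>\<open>clamp_norm r\<close> is the radial retraction onto the closed disc of radius
  \<open>r\<close>; the maximum keeps the divisor at least 1, so no case distinction at the circle
  is needed.\<close>

lemma clamp_norm_continuous:
  assumes "r > 0"
  shows "continuous_on UNIV (clamp_norm r)"
  unfolding clamp_norm_def using assms by (intro continuous_intros) auto

lemma clamp_norm_measurable:
  assumes "r > 0"
  shows "clamp_norm r \<in> borel_measurable borel"
  by (intro borel_measurable_continuous_onI clamp_norm_continuous assms)

lemma cmod_clamp_norm_le:
  assumes "r > 0"
  shows "cmod (clamp_norm r z) \<le> r" "cmod (clamp_norm r z) \<le> cmod z"
proof -
  have m: "max 1 (cmod z / r) \<ge> 1"
    by simp
  have "cmod z \<le> r * max 1 (cmod z / r)"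
    using assms by (simp add: max_mult_distrib_left)
  then show "cmod (clamp_norm r z) \<le> r"
    using m by (simp add: clamp_norm_def field_simps)
  show "cmod (clamp_norm r z) \<le> cmod z"
    using m mult_left_mono[OF m, of "cmod z"] by (simp add: clamp_norm_def field_simps)
qed

lemma clamp_norm_tendsto: "(\<lambda>n. clamp_norm (real (Suc n)) z) \<longlonglongrightarrow> z"
proof (rule tendsto_eventually)
  obtain N where "cmod z \<le> real N"
    using real_arch_simple by blast
  then have "max 1 (cmod z / real (Suc n)) = 1" if "n \<ge> N" for n
    using that by (simp add: field_simps)
  then have "clamp_norm (real (Suc n)) z = z" if "n \<ge> N" for n
    using that by (simp only: clamp_norm_def inverse_1 scaleR_one)
  then show "\<forall>\<^sub>F n in sequentially. clamp_norm (real (Suc n)) z = z"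
    by (rule eventually_sequentiallyI)
qed

lemma L2_sq_tendsto_0:
  fixes w :: "'a::euclidean_space \<Rightarrow> real"
  assumes [measurable]: "\<And>k. F k \<in> borel_measurable borel"
    and lim: "AE x in lborel. (\<lambda>k. F k x) \<longlonglongrightarrow> 0"
    and w: "integrable lborel w" and bound: "\<And>k x. (cmod (F k x))\<^sup>2 \<le> w x"
  shows "(\<lambda>k. L2_sq (F k)) \<longlonglongrightarrow> 0"
proof -
  have "w x \<ge> 0" for x
    using order_trans[OF zero_le_power2 bound] by blast
  then have w': "(\<integral>\<^sup>+x. ennreal (w x) \<partial>lborel) < \<infinity>"
    using w by (simp add: nn_integral_eq_integral)
  have [measurable]: "w \<in> borel_measurable borel"
    using w by auto
  have "(\<lambda>k. \<integral>\<^sup>+x. ennreal ((cmod (F k x))\<^sup>2) \<partial>lborel) \<longlonglongrightarrow> (\<integral>\<^sup>+(x::'a). 0 \<partial>lborel)"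
  proof (rule nn_integral_dominated_convergence[OF _ _ _ _ w'])
    show "AE x in lborel. (\<lambda>k. ennreal ((cmod (F k x))\<^sup>2)) \<longlonglongrightarrow> 0"
      using lim
    proof eventually_elim
      case (elim x)
      then have "(\<lambda>k. (cmod (F k x))\<^sup>2) \<longlonglongrightarrow> (cmod 0)\<^sup>2"
        by (intro tendsto_intros)
      then show ?case
        using tendsto_ennrealI by fastforce
    qed
  qed (use bound in \<open>auto intro!: ennreal_leI\<close>)
  then show ?thesis
    by (simp add: L2_sq_def)
qed

text \<open>Pointwise approximation by continuous functions carries no control of norms. Clamping
  the values and damping at infinity, applied alike to \<open>f\<close> and to its approximants,
  restores an integrable bound.\<close>

lemma bcont_L1_dense:
  fixes f :: "'a::euclidean_space \<Rightarrow> complex"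
  assumes f: "f \<in> L2_space" and e: "e > 0"
  shows "\<exists>h. bcont_L1 h \<and> L2_sq (\<lambda>x. f x - h x) < e"
proof -
  have [measurable]: "f \<in> borel_measurable borel" and fint: "integrable lborel (\<lambda>x. (cmod (f x))\<^sup>2)"
    using f by (auto simp: L2_space_def)
  \<comment> \<open>This notion of measurability provides continuous functions \<open>g n\<close>
    that converge to \<open>f\<close> off a negligible set.\<close>
  have "f measurable_on UNIV"
    by (rule lebesgue_measurable_imp_measurable_on) (auto intro: measurable_completion)
  then obtain N g where N: "negligible N" and gc: "\<And>n. continuous_on UNIV (g n)"
    and glim: "\<And>x. x \<notin> N \<Longrightarrow> (\<lambda>n. g n x) \<longlonglongrightarrow> f x"
    by (auto simp: measurable_on_def)
  have [measurable]: "g n \<in> borel_measurable borel" for n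
    by (intro borel_measurable_continuous_onI gc)
  let ?c = "\<lambda>k z. clamp_norm (real (Suc k)) z"
  let ?d = "\<lambda>k x. damp (1 / real (Suc k)) x"
  have [measurable]: "?c k \<in> borel_measurable borel" for k
    by (intro clamp_norm_measurable) simp
  have dc: "continuous_on UNIV (?d k)" for k
    unfolding damp_def by (intro continuous_intros) auto
  have c1: "cmod (?c k z) \<le> real (Suc k)" and c2: "cmod (?c k z) \<le> cmod z" for k z
    by (intro cmod_clamp_norm_le; simp)+
  define F where "F k x = ?d k x *\<^sub>R ?c k (f x)" for k x
  define H where "H k n x = ?d k x *\<^sub>R ?c k (g n x)" for k n x
  have [measurable]: "F k \<in> borel_measurable borel" "H k n \<in> borel_measurable borel" for k n
    unfolding F_def H_def by measurable
  have Fle: "cmod (F k x) \<le> cmod (f x)" for k x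
  proof -
    have "cmod (F k x) = ?d k x * cmod (?c k (f x))"
      by (simp add: F_def)
    also have "\<dots> \<le> 1 * cmod (f x)"
      by (intro mult_mono c2) auto
    finally show ?thesis by simp
  qed
  have "(\<lambda>k. L2_sq (\<lambda>x. f x - F k x)) \<longlonglongrightarrow> 0"
  proof (rule L2_sq_tendsto_0)
    show "integrable lborel (\<lambda>x. 4 * (cmod (f x))\<^sup>2)"
      using fint by simp
    have "cmod (f x - F k x) \<le> 2 * cmod (f x)" for k x
      using norm_triangle_ineq4[of "f x" "F k x"] Fle[of k x] by simp
    then have "(cmod (f x - F k x))\<^sup>2 \<le> (2 * cmod (f x))\<^sup>2" for k x
      by (intro power_mono) auto
    then show "(cmod (f x - F k x))\<^sup>2 \<le> 4 * (cmod (f x))\<^sup>2" for k x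
      by (simp add: power_mult_distrib)
    have "(\<lambda>k. f x - F k x) \<longlonglongrightarrow> f x - 1 *\<^sub>R f x" for x
      unfolding F_def by (intro tendsto_intros damp_tendsto_1 clamp_norm_tendsto)
    then show "AE x in lborel. (\<lambda>k. f x - F k x) \<longlonglongrightarrow> 0"
      by simp
  qed measurable
  then have "\<forall>\<^sub>F k in sequentially. L2_sq (\<lambda>x. f x - F k x) < e / 4"
    using e by (intro order_tendstoD) (auto simp: ennreal_zero_less_divide)
  \<comment> \<open>The quarter of \<open>e\<close> compensates for the two factors 2 in
    \<open>L2_sq_diff_le\<close>.\<close>
  then obtain k where k: "L2_sq (\<lambda>x. f x - F k x) < e / 4"
    by (auto simp: eventually_sequentially)
  \<comment> \<open>With \<open>k\<close> fixed, both functions are at most (k+1) times the same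
    Gaussian, which dominates uniformly in \<open>n\<close>.\<close>
  have "(\<lambda>n. L2_sq (\<lambda>x. F k x - H k n x)) \<longlonglongrightarrow> 0"
  proof (rule L2_sq_tendsto_0)
    let ?M = "real (Suc k)"
    show "integrable lborel (\<lambda>x::'a. (2 * ?M)\<^sup>2 * ?d k x)"
      by (intro integrable_mult_right damp_integrable) simp
    show "(cmod (F k x - H k n x))\<^sup>2 \<le> (2 * ?M)\<^sup>2 * ?d k x" for n x
    proof -
      have "F k x - H k n x = ?d k x *\<^sub>R (?c k (f x) - ?c k (g n x))"
        by (simp add: F_def H_def scaleR_diff_right)
      then have "(cmod (F k x - H k n x))\<^sup>2 = (cmod (?c k (f x) - ?c k (g n x)))\<^sup>2 * (?d k x)\<^sup>2"
        by (simp add: power_mult_distrib)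
      also have "\<dots> \<le> (2 * ?M)\<^sup>2 * ?d k x"
      proof (intro mult_mono power_mono)
        show "cmod (?c k (f x) - ?c k (g n x)) \<le> 2 * ?M"
          using norm_triangle_ineq4[of "?c k (f x)" "?c k (g n x)"] c1[of k "f x"] c1[of k "g n x"] by simp
        show "(?d k x)\<^sup>2 \<le> ?d k x"
          by (simp add: power2_eq_square mult_left_le)
      qed auto
      finally show ?thesis .
    qed
    have "AE x in lborel. x \<notin> N"
      using AE_not_in[OF N[unfolded negligible_iff_null_sets]] by (simp only: AE_completion_iff)
    then show "AE x in lborel. (\<lambda>n. F k x - H k n x) \<longlonglongrightarrow> 0"
    proof eventually_elim
      case (elim x)
      have "(\<lambda>n. ?c k (g n x)) \<longlonglongrightarrow> ?c k (f x)"
        using clamp_norm_continuous[of "real (Suc k)"] glim[OF elim]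
        by (intro isCont_tendsto_compose[of _ "?c k"]) (auto simp: continuous_on_eq_continuous_at)
      then have "(\<lambda>n. F k x - H k n x) \<longlonglongrightarrow> F k x - ?d k x *\<^sub>R ?c k (f x)"
        unfolding H_def by (intro tendsto_intros)
      then show ?case
        by (simp add: F_def)
    qed
  qed measurable
  then have "\<forall>\<^sub>F n in sequentially. L2_sq (\<lambda>x. F k x - H k n x) < e / 4"
    using e by (intro order_tendstoD) (auto simp: ennreal_zero_less_divide)
  then obtain n where n: "L2_sq (\<lambda>x. F k x - H k n x) < e / 4"
    by (auto simp: eventually_sequentially)
  have H: "cmod (H k n x) \<le> real (Suc k) * ?d k x" for x
  proof -
    have "cmod (H k n x) = cmod (?c k (g n x)) * ?d k x"
      by (simp add: H_def)
    also have "\<dots> \<le> real (Suc k) * ?d k x"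
      by (intro mult_right_mono c1) auto
    finally show ?thesis .
  qed
  have "bcont_L1 (H k n)"
    unfolding bcont_L1_def
  proof (intro conjI)
    show "continuous_on UNIV (H k n)"
      unfolding H_def
      by (intro continuous_on_scaleR dc continuous_on_compose2[OF clamp_norm_continuous gc]) auto
    show "bounded (range (H k n))"
      unfolding bounded_iff
      by (intro exI[of _ "real (Suc k)"]) (auto intro!: order_trans[OF H] mult_left_le)
    show "integrable lborel (H k n)"
    proof (rule Bochner_Integration.integrable_bound)
      show "integrable lborel (\<lambda>x::'a. real (Suc k) * ?d k x)"
        by (intro integrable_mult_right damp_integrable) simp
      show "AE x in lborel. norm (H k n x) \<le> norm (real (Suc k) * ?d k x)"
        by (intro AE_I2 order_trans[OF H]) simp
    qed measurable
  qed
  moreover have "L2_sq (\<lambda>x. f x - H k n x) < e"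
  proof -
    have "L2_sq (\<lambda>x. f x - H k n x) \<le> 2 * L2_sq (\<lambda>x. f x - F k x) + 2 * L2_sq (\<lambda>x. F k x - H k n x)"
      by (rule L2_sq_diff_le) measurable
    also have "\<dots> < 2 * (e / 4) + 2 * (e / 4)"
      using k n by (intro add_strict_mono ennreal_mult_strict_left_mono) auto
    also have "\<dots> = e"
      by (cases e) (auto simp: ennreal_top_divide divide_ennreal simp flip: ennreal_numeral ennreal_mult ennreal_plus)
    finally show ?thesis .
  qed
  ultimately show ?thesis
    by blast
qed

text \<open>Only the lower bound is new. It passes from \<open>bcont_L1\<close> functions to
  \<open>f\<close> through limits in the square norm on both sides.\<close>

lemma plancherel_L1_L2:
  assumes f: "f \<in> L2_space" "integrable lborel f"
  shows "L2_sq (fourier f) = L2_sq f"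
proof (rule antisym)
  show "L2_sq (fourier f) \<le> L2_sq f"
    by (rule bessel[OF f(2)])
  have "\<exists>h. bcont_L1 h \<and> L2_sq (\<lambda>x. f x - h x) < ennreal (1 / real (Suc k))" for k
    by (rule bcont_L1_dense[OF f(1)]) simp
  then obtain h where h: "\<And>k. bcont_L1 (h k)"
    "\<And>k. L2_sq (\<lambda>x. f x - h k x) < ennreal (1 / real (Suc k))"
    by metis
  have [measurable]: "f \<in> borel_measurable borel" "\<And>k. h k \<in> borel_measurable borel"
    using f bcont_L1_measurable[OF h(1)] by (auto simp: L2_space_iff)
  have lim: "(\<lambda>k. ennreal (1 / real (Suc k))) \<longlonglongrightarrow> 0"
    using tendsto_ennrealI[OF LIMSEQ_Suc[OF lim_const_over_n[of "1::real"]]] by simp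
  show "L2_sq f \<le> L2_sq (fourier f)"
  proof (rule L2_sq_le_limit[where fs = h and Fs = "\<lambda>k. fourier (h k)"])
    have le: "L2_sq (\<lambda>x. h k x - f x) \<le> ennreal (1 / real (Suc k))" for k
      using h(2)[of k] L2_sq_commute[of "h k" f] by simp
    show "L2_tendsto h f"
      unfolding L2_tendsto_iff
      by (rule tendsto_sandwich[OF _ _ tendsto_const lim]) (use le in auto)
    have "L2_sq (\<lambda>x. fourier (h k) x - fourier f x) \<le> L2_sq (\<lambda>x. h k x - f x)" for k
      using bessel[of "\<lambda>x. h k x - f x"] bcont_L1_integrable[OF h(1)] f
      by (simp add: fourier_diff)
    with le have "L2_sq (\<lambda>x. fourier (h k) x - fourier f x) \<le> ennreal (1 / real (Suc k))" for k
      using order_trans by blast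
    then show "L2_tendsto (\<lambda>k. fourier (h k)) (fourier f)"
      unfolding L2_tendsto_iff
      by (intro tendsto_sandwich[OF _ _ tendsto_const lim]) auto
    show "L2_sq (h k) \<le> L2_sq (fourier (h k))" for k
      by (rule bcont_L1_plancherel[OF h(1)])
  qed (auto intro: fourier_measurable)
qed

subsection \<open>Density of the range and completeness\<close>

text \<open>Conjugation turns the inversion kernel into the forward kernel. Conjugated
  mollifications therefore lie in the range of \<open>fourier\<close>, with an explicit
  preimage.\<close>

lemma cnj_mollify_eq_fourier:
  fixes h :: "'a::euclidean_space \<Rightarrow> complex"
  assumes h: "integrable lborel h" and a: "a > 0"
  shows "fourier (\<lambda>\<xi>. cnj (fourier h \<xi> * complex_of_real (damp a \<xi>))) x = cnj (mollify a h x)"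
  unfolding mollify_eq_fourier_inversion[OF h a]
  by (subst Bochner_Integration.integral_cnj[symmetric]) (simp add: fourier_def exp_cnj inner_commute)

lemma bcont_L1_fourier_damp:
  assumes h: "bcont_L1 h" and a: "a > 0"
  defines "b \<equiv> \<lambda>\<xi>. cnj (fourier h \<xi> * complex_of_real (damp a \<xi>))"
  shows "integrable lborel b" "b \<in> L2_space" "L2_sq b \<le> L2_sq h"
proof -
  note [measurable] = bcont_L1_measurable[OF h] fourier_measurable[OF bcont_L1_measurable[OF h]]
  show "integrable lborel b"
    unfolding b_def using integrable_fourier_damp[OF bcont_L1_integrable[OF h] a]
    by (intro Bochner_Integration.integrable_cnj)
  have "L2_sq b \<le> L2_sq (fourier h)"
    unfolding L2_sq_def b_def
    by (intro nn_integral_mono ennreal_leI power_mono) (auto simp: norm_mult intro!: mult_left_le)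
  also have "\<dots> \<le> L2_sq h"
    by (rule bessel[OF bcont_L1_integrable[OF h]])
  finally show le: "L2_sq b \<le> L2_sq h" .
  show "b \<in> L2_space"
    using bcont_L1_L2[OF h] le by (auto simp: L2_space_iff b_def)
qed

text \<open>The square norm of the difference expands into two square norms minus twice the real
  part of the pairing. The norm of the mollification is at most that of \<open>h\<close>, by Bessel
  for \<open>h\<close> and again for its damped transform; the pairing tends to the square norm of
  \<open>h\<close>.\<close>

lemma mollify_L2_tendsto:
  assumes h: "bcont_L1 h"
  shows "L2_tendsto (\<lambda>n. mollify (1 / real (Suc n)) h) h"
proof -
  note [measurable] = bcont_L1_measurable[OF h] mollify_measurable[OF bcont_L1_measurable[OF h]]
  let ?K = "\<lambda>n. mollify (1 / real (Suc n)) h"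
  let ?I = "LINT x|lborel. (cmod (h x))\<^sup>2"
  have K: "L2_sq (?K n) \<le> ennreal ?I" for n
  proof -
    let ?b = "\<lambda>\<xi>. cnj (fourier h \<xi> * complex_of_real (damp (1 / real (Suc n)) \<xi>))"
    have "L2_sq (?K n) = L2_sq (\<lambda>x. cnj (?K n x))"
      by (simp add: L2_sq_cnj)
    also have "\<dots> = L2_sq (fourier ?b)"
      by (subst cnj_mollify_eq_fourier[OF bcont_L1_integrable[OF h], symmetric]) auto
    also have "\<dots> \<le> L2_sq ?b"
      by (intro bessel bcont_L1_fourier_damp[OF h]) auto
    also have "\<dots> \<le> L2_sq h"
      by (intro bcont_L1_fourier_damp[OF h]) auto
    finally show ?thesis
      by (simp add: bcont_L1_L2_sq[OF h])
  qed
  have Kint: "integrable lborel (\<lambda>x. (cmod (?K n x))\<^sup>2)" and KI: "(LINT x|lborel. (cmod (?K n x))\<^sup>2) \<le> ?I" for n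
  proof -
    have "?K n \<in> L2_space"
      using K[of n] by (auto simp: L2_space_iff less_top[symmetric] top_unique)
    then show i: "integrable lborel (\<lambda>x. (cmod (?K n x))\<^sup>2)"
      by (simp add: L2_space_def)
    show "(LINT x|lborel. (cmod (?K n x))\<^sup>2) \<le> ?I"
      using K[of n] i by (simp add: L2_sq_def nn_integral_eq_integral integral_nonneg_AE)
  qed
  note hint = bcont_L1_square_integrable[OF h] and Kh = mollify_pairing_tendsto(2)[OF h]
  let ?p = "\<lambda>n. LINT x|lborel. ?K n x * cnj (h x)"
  have eq: "(cmod (?K n x - h x))\<^sup>2 = (cmod (?K n x))\<^sup>2 + (cmod (h x))\<^sup>2 - 2 * Re (?K n x * cnj (h x))" for n x
    by (simp add: cmod_power2 power2_diff algebra_simps)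
  have le: "L2_sq (\<lambda>x. ?K n x - h x) \<le> ennreal (2 * (?I - Re (?p n)))" for n
  proof -
    have int: "integrable lborel (\<lambda>x. (cmod (?K n x - h x))\<^sup>2)"
      unfolding eq
      by (intro Bochner_Integration.integrable_diff Bochner_Integration.integrable_add
          integrable_mult_right Bochner_Integration.integrable_Re Kint hint Kh)
    have "(LINT x|lborel. (cmod (?K n x - h x))\<^sup>2) =
        (LINT x|lborel. (cmod (?K n x))\<^sup>2) + ?I - 2 * Re (?p n)"
      unfolding eq using Kint[of n] hint Kh[of n]
      by (subst Bochner_Integration.integral_diff) (auto simp del: times_complex.sel)
    also have "\<dots> \<le> 2 * (?I - Re (?p n))"
      using KI[of n] by simp
    finally show ?thesis
      using int by (simp add: L2_sq_def nn_integral_eq_integral ennreal_leI)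
  qed
  have "(\<lambda>n. ennreal (2 * (?I - Re (?p n)))) \<longlonglongrightarrow> ennreal (2 * (?I - Re (complex_of_real ?I)))"
    by (intro tendsto_ennrealI tendsto_intros mollify_pairing_tendsto(1)[OF h])
  then have lim: "(\<lambda>n. ennreal (2 * (?I - Re (?p n)))) \<longlonglongrightarrow> 0"
    by simp
  show ?thesis
    unfolding L2_tendsto_iff by (rule tendsto_sandwich[OF _ _ tendsto_const lim]) (use le in auto)
qed

text \<open>The conjugate of \<open>G\<close> is approximated rather than \<open>G\<close>, since
  the elements known to lie in the range are conjugates of mollifications.\<close>

lemma fourier_range_dense:
  fixes G :: "'a::euclidean_space \<Rightarrow> complex"
  assumes G: "G \<in> L2_space" and e: "e > 0"
  shows "\<exists>b \<in> L2_space. integrable lborel b \<and> L2_sq (\<lambda>x. G x - fourier b x) < e"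
proof -
  have [measurable]: "G \<in> borel_measurable borel"
    using G by (simp add: L2_space_iff)
  have "(\<lambda>x. cnj (G x)) \<in> L2_space"
    using G by (auto simp: L2_space_iff L2_sq_cnj)
  moreover have e4: "e / 4 > 0"
    using e by (simp add: ennreal_zero_less_divide)
  ultimately obtain h where h: "bcont_L1 h" "L2_sq (\<lambda>x. cnj (G x) - h x) < e / 4"
    using bcont_L1_dense by blast
  have "\<forall>\<^sub>F n in sequentially. L2_sq (\<lambda>x. mollify (1 / real (Suc n)) h x - h x) < e / 4"
    using mollify_L2_tendsto[OF h(1)] e4 unfolding L2_tendsto_iff by (rule order_tendstoD)
  then obtain n where n: "L2_sq (\<lambda>x. h x - mollify (1 / real (Suc n)) h x) < e / 4"
    by (auto simp: eventually_sequentially L2_sq_commute[of h])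
  note [measurable] = bcont_L1_measurable[OF h(1)] mollify_measurable[OF bcont_L1_measurable[OF h(1)]]
  let ?b = "\<lambda>\<xi>. cnj (fourier h \<xi> * complex_of_real (damp (1 / real (Suc n)) \<xi>))"
  have "L2_sq (\<lambda>x. G x - fourier ?b x) = L2_sq (\<lambda>x. cnj (cnj (G x) - mollify (1 / real (Suc n)) h x))"
    by (subst cnj_mollify_eq_fourier[OF bcont_L1_integrable[OF h(1)]]) auto
  also have "\<dots> = L2_sq (\<lambda>x. cnj (G x) - mollify (1 / real (Suc n)) h x)"
    by (rule L2_sq_cnj)
  also have "\<dots> \<le> 2 * L2_sq (\<lambda>x. cnj (G x) - h x) + 2 * L2_sq (\<lambda>x. h x - mollify (1 / real (Suc n)) h x)"
    by (rule L2_sq_diff_le) measurable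
  also have "\<dots> < 2 * (e / 4) + 2 * (e / 4)"
    using h(2) n by (intro add_strict_mono ennreal_mult_strict_left_mono) auto
  also have "\<dots> = e"
    by (cases e) (auto simp: ennreal_top_divide divide_ennreal simp flip: ennreal_numeral ennreal_mult ennreal_plus)
  finally show ?thesis
    using bcont_L1_fourier_damp[OF h(1), of "1 / real (Suc n)"] by (intro bexI[of _ ?b]) auto
qed

text \<open>The rate 8^(-k) bounds squared norms; after weighting by 2^k the summable 4^(-k)
  remains, which forces almost everywhere convergence of the sequence itself.\<close>

lemma riesz_fischer:
  fixes F :: "nat \<Rightarrow> 'a::euclidean_space \<Rightarrow> complex"
  assumes F: "\<And>k. F k \<in> L2_space"
    and cauchy: "\<And>k j. k \<le> j \<Longrightarrow> L2_sq (\<lambda>x. F j x - F k x) \<le> ennreal (1 / 8 ^ k)"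
  obtains G where "G \<in> L2_space" "L2_tendsto F G"
proof -
  have [measurable]: "F k \<in> borel_measurable borel" for k
    using F by (auto simp: L2_space_iff)
  define G where "G x = lim (\<lambda>k. F k x)" for x
  have [measurable]: "G \<in> borel_measurable borel"
    unfolding G_def by (rule borel_measurable_lim_metric) measurable
  \<comment> \<open>The weights make square summability of the increments imply summability: $d \le 2^{-k} + 2^k d^2$.\<close>
  let ?t = "\<lambda>k x. 2 ^ k * (cmod (F (Suc k) x - F k x))\<^sup>2"
  have "(\<integral>\<^sup>+x. (\<Sum>k. ennreal (?t k x)) \<partial>lborel) = (\<Sum>k. \<integral>\<^sup>+x. ennreal (?t k x) \<partial>lborel)"
    by (rule nn_integral_suminf) measurable
  also have "\<dots> \<le> (\<Sum>k. ennreal ((1 / 4) ^ k))"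
  proof (intro suminf_le)
    fix k
    have "(\<integral>\<^sup>+x. ennreal (?t k x) \<partial>lborel) = ennreal (2 ^ k) * L2_sq (\<lambda>x. F (Suc k) x - F k x)"
      by (simp add: ennreal_mult L2_sq_def nn_integral_cmult)
    also have "\<dots> \<le> ennreal (2 ^ k) * ennreal (1 / 8 ^ k)"
      by (intro mult_left_mono cauchy) auto
    also have "\<dots> = ennreal ((1 / 4) ^ k)"
      by (simp add: power_divide flip: ennreal_mult power_mult_distrib)
        (simp add: field_simps flip: power_mult_distrib)
    finally show "(\<integral>\<^sup>+x. ennreal (?t k x) \<partial>lborel) \<le> ennreal ((1 / 4) ^ k)" .
  qed auto
  also have "\<dots> = ennreal (\<Sum>k. (1 / 4) ^ k)"
    by (intro suminf_ennreal2) (auto intro: summable_geometric)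
  finally have "(\<integral>\<^sup>+x. (\<Sum>k. ennreal (?t k x)) \<partial>lborel) \<noteq> \<infinity>"
    by (auto simp: top_unique)
  then have "AE x in lborel. (\<Sum>k. ennreal (?t k x)) \<noteq> \<infinity>"
    by (intro nn_integral_PInf_AE) auto
  then have lim: "AE x in lborel. (\<lambda>k. F k x) \<longlonglongrightarrow> G x"
  proof eventually_elim
    case (elim x)
    then have "summable (\<lambda>k. ?t k x)"
      by (intro summable_suminf_not_top) auto
    then have "summable (\<lambda>k. (1 / 2) ^ k + ?t k x)"
      by (intro summable_add summable_geometric) auto
    moreover have "cmod (F (Suc k) x - F k x) \<le> (1 / 2) ^ k + ?t k x" for k
    proof -
      let ?d = "cmod (F (Suc k) x - F k x)"
      have "0 \<le> 2 ^ k * ((1 / 2) ^ k - ?d)\<^sup>2"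
        by simp
      also have "\<dots> = (1 / 2) ^ k + ?t k x - 2 * ?d"
        by (simp add: power2_diff power_one_over field_simps) (simp add: power2_eq_square)
      finally show ?thesis
        using norm_ge_zero[of "F (Suc k) x - F k x"] by linarith
    qed
    ultimately have "summable (\<lambda>k. F (Suc k) x - F k x)"
      by (rule summable_comparison_test'[where N = 0])
    then have "convergent (\<lambda>k. F k x)"
      unfolding summable_iff_convergent sum_lessThan_telescope[of "\<lambda>k. F k x"]
      by (simp add: convergent_diff_const_right_iff)
    then show ?case
      by (simp add: G_def convergent_LIMSEQ_iff)
  qed
  \<comment> \<open>Fatou's lemma in the later index \<open>j\<close> carries the Cauchy bound over
    to the pointwise limit.\<close>
  have le: "L2_sq (\<lambda>x. F k x - G x) \<le> ennreal (1 / 8 ^ k)" for k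
  proof -
    have "L2_sq (\<lambda>x. F k x - G x) = (\<integral>\<^sup>+x. liminf (\<lambda>j. ennreal ((cmod (F k x - F j x))\<^sup>2)) \<partial>lborel)"
      unfolding L2_sq_def
    proof (rule nn_integral_cong_AE)
      show "AE x in lborel. ennreal ((cmod (F k x - G x))\<^sup>2) = liminf (\<lambda>j. ennreal ((cmod (F k x - F j x))\<^sup>2))"
        using lim
      proof eventually_elim
        case (elim x)
        then have "(\<lambda>j. ennreal ((cmod (F k x - F j x))\<^sup>2)) \<longlonglongrightarrow> ennreal ((cmod (F k x - G x))\<^sup>2)"
          by (intro tendsto_ennrealI tendsto_power tendsto_norm tendsto_diff tendsto_const)
        then show ?case
          using lim_imp_Liminf[OF sequentially_bot] by metis
      qed
    qed
    also have "\<dots> \<le> liminf (\<lambda>j. L2_sq (\<lambda>x. F k x - F j x))"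
      unfolding L2_sq_def by (rule nn_integral_liminf) measurable
    also have "\<dots> \<le> ennreal (1 / 8 ^ k)"
      by (intro Liminf_le eventually_sequentiallyI[of k]) (auto simp: L2_sq_commute[of "F k"] cauchy)
    finally show ?thesis .
  qed
  show ?thesis
  proof
    have "L2_sq G \<le> 2 * L2_sq (F 0) + 2 * L2_sq (\<lambda>x. F 0 x - G x)"
      using L2_sq_le_peter_paul[of G "F 0" 1] by (simp add: L2_sq_commute[of G])
    also have "\<dots> < \<infinity>"
      using F[of 0] le_less_trans[OF le[of 0] ennreal_less_top] by (simp add: L2_space_iff ennreal_mult_less_top)
    finally show "G \<in> L2_space"
      by (simp add: L2_space_iff)
    have "(\<lambda>k. ennreal ((1 / 8) ^ k)) \<longlonglongrightarrow> ennreal 0"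
      by (intro tendsto_ennrealI LIMSEQ_power_zero) simp
    then have lim': "(\<lambda>k. ennreal (1 / 8 ^ k)) \<longlonglongrightarrow> 0"
      by (simp add: power_one_over)
    show "L2_tendsto F G"
      unfolding L2_tendsto_iff by (rule tendsto_sandwich[OF _ _ tendsto_const lim']) (use le in auto)
  qed
qed

subsection \<open>The Fourier transform on $L^2$\<close>

lemma L2_space_diff:
  assumes "f \<in> L2_space" "g \<in> L2_space"
  shows "(\<lambda>x. f x - g x) \<in> L2_space"
proof -
  have [measurable]: "f \<in> borel_measurable borel" "g \<in> borel_measurable borel"
    using assms by (auto simp: L2_space_iff)
  have "L2_sq (\<lambda>x. f x - g x) \<le> 2 * L2_sq (\<lambda>x. f x - 0) + 2 * L2_sq (\<lambda>x. 0 - g x)"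
    by (rule L2_sq_diff_le) measurable
  also have "\<dots> < \<infinity>"
    using assms L2_sq_commute[of "\<lambda>_. 0" g] by (auto simp: L2_space_iff ennreal_mult_less_top)
  finally show ?thesis
    by (simp add: L2_space_iff)
qed

lemma L2_tendsto_diff:
  assumes "\<And>k. fs k \<in> L2_space" "\<And>k. gs k \<in> L2_space" "f \<in> L2_space" "g \<in> L2_space"
    and f: "L2_tendsto fs f" and g: "L2_tendsto gs g"
  shows "L2_tendsto (\<lambda>k x. fs k x - gs k x) (\<lambda>x. f x - g x)"
proof -
  have [measurable]: "fs k \<in> borel_measurable borel" "gs k \<in> borel_measurable borel"
    "f \<in> borel_measurable borel" "g \<in> borel_measurable borel" for k
    using assms by (auto simp: L2_space_iff)
  let ?r = "\<lambda>k. 2 * L2_sq (\<lambda>x. fs k x - f x) + 2 * L2_sq (\<lambda>x. gs k x - g x)"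
  have "?r \<longlonglongrightarrow> 2 * 0 + 2 * 0"
    using f g by (intro tendsto_add ennreal_tendsto_cmult) (auto simp: L2_tendsto_iff)
  then have lim: "?r \<longlonglongrightarrow> 0"
    by simp
  have le: "L2_sq (\<lambda>x. (fs k x - gs k x) - (f x - g x)) \<le> ?r k" for k
  proof -
    have "L2_sq (\<lambda>x. (fs k x - f x) - (gs k x - g x)) \<le>
        2 * L2_sq (\<lambda>x. (fs k x - f x) - 0) + 2 * L2_sq (\<lambda>x. 0 - (gs k x - g x))"
      by (rule L2_sq_diff_le) measurable
    then show ?thesis
      using L2_sq_commute[of "\<lambda>_. 0" "\<lambda>x. gs k x - g x"] by (simp add: algebra_simps)
  qed
  show ?thesis
    unfolding L2_tendsto_iff by (rule tendsto_sandwich[OF _ _ tendsto_const lim]) (use le in auto)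
qed

lemma L2_sq_eq_0_iff:
  assumes "f \<in> borel_measurable borel"
  shows "L2_sq f = 0 \<longleftrightarrow> (AE x in lborel. f x = 0)"
  using assms by (simp add: L2_sq_def nn_integral_0_iff_AE)

text \<open>The 4 in the rate absorbs the constants of \<open>L2_sq_diff_le\<close>: two terms, each
  2 times a quarter, give exactly the rate that \<open>riesz_fischer\<close> expects.\<close>

lemma rapid_tendsto:
  fixes f :: "'a::euclidean_space \<Rightarrow> complex"
  assumes f: "f \<in> borel_measurable borel" "\<And>k. h k \<in> borel_measurable borel"
    and le: "\<And>k. L2_sq (\<lambda>x. f x - h k x) \<le> ennreal (1 / (4 * 8 ^ k))"
  shows "L2_tendsto h f"
    and "k \<le> j \<Longrightarrow> L2_sq (\<lambda>x. h j x - h k x) \<le> ennreal (1 / 8 ^ k)"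
proof -
  note [measurable] = f
  have "(\<lambda>k. ennreal ((1 / 8) ^ k * (1 / 4))) \<longlonglongrightarrow> ennreal (0 * (1 / 4))"
    by (intro tendsto_ennrealI tendsto_mult_right LIMSEQ_power_zero) simp
  then have lim: "(\<lambda>k. ennreal (1 / (4 * 8 ^ k))) \<longlonglongrightarrow> 0"
    by (simp add: power_one_over mult_ac)
  show "L2_tendsto h f"
    unfolding L2_tendsto_iff
    by (rule tendsto_sandwich[OF _ _ tendsto_const lim]) (use le in \<open>auto simp: L2_sq_commute[of _ f]\<close>)
  assume kj: "k \<le> j"
  have "L2_sq (\<lambda>x. h j x - h k x) \<le> 2 * L2_sq (\<lambda>x. h j x - f x) + 2 * L2_sq (\<lambda>x. f x - h k x)"
    by (rule L2_sq_diff_le) measurable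
  also have "\<dots> \<le> 2 * ennreal (1 / (4 * 8 ^ k)) + 2 * ennreal (1 / (4 * 8 ^ k))"
  proof (intro add_mono mult_left_mono le)
    have "ennreal (1 / (4 * 8 ^ j)) \<le> ennreal (1 / (4 * 8 ^ k))"
      using kj by (intro ennreal_leI divide_left_mono mult_left_mono power_increasing) auto
    then show "L2_sq (\<lambda>x. h j x - f x) \<le> ennreal (1 / (4 * 8 ^ k))"
      by (subst L2_sq_commute) (rule order_trans[OF le])
  qed auto
  also have "\<dots> = ennreal (1 / 8 ^ k)"
    by (simp add: field_simps flip: ennreal_numeral ennreal_mult ennreal_plus)
  finally show "L2_sq (\<lambda>x. h j x - h k x) \<le> ennreal (1 / 8 ^ k)" .
qed

text \<open>This is the predicate under the choice in \<open>L2_fourier\<close>; naming it allows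
  arbitrary candidates to be compared with the chosen one.\<close>

definition is_L2_fourier :: "('a::euclidean_space \<Rightarrow> complex) \<Rightarrow> ('a \<Rightarrow> complex) \<Rightarrow> bool" where
  "is_L2_fourier f F \<longleftrightarrow> F \<in> L2_space \<and>
     (\<exists>fs. (\<forall>k. fs k \<in> L2_space \<and> integrable lborel (fs k)) \<and>
           L2_tendsto fs f \<and> L2_tendsto (\<lambda>k. fourier (fs k)) F)"

lemma fourier_L2_space:
  assumes "f \<in> L2_space" "integrable lborel f"
  shows "fourier f \<in> L2_space"
  using assms plancherel_L1_L2[OF assms] by (auto simp: L2_space_iff fourier_measurable)

text \<open>Plancherel transports the Cauchy rate of an approximating sequence to its transforms,
  and completeness yields the limit.\<close>

lemma is_L2_fourier_exists:
  assumes f: "f \<in> L2_space"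
  shows "\<exists>F. is_L2_fourier f F"
proof -
  have "\<exists>h. bcont_L1 h \<and> L2_sq (\<lambda>x. f x - h x) < ennreal (1 / (4 * 8 ^ k))" for k :: nat
    by (rule bcont_L1_dense[OF f]) simp
  then obtain h where h: "\<And>k. bcont_L1 (h k)"
    "\<And>k. L2_sq (\<lambda>x. f x - h k x) < ennreal (1 / (4 * 8 ^ k))"
    by metis
  note hL2 = bcont_L1_L2[OF h(1)] and hL1 = bcont_L1_integrable[OF h(1)]
  have fm: "f \<in> borel_measurable borel"
    using f by (simp add: L2_space_iff)
  note rapid = rapid_tendsto[OF fm bcont_L1_measurable[OF h(1)] less_imp_le[OF h(2)]]
  have cauchy: "L2_sq (\<lambda>\<xi>. fourier (h j) \<xi> - fourier (h k) \<xi>) \<le> ennreal (1 / 8 ^ k)" if "k \<le> j" for k j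
  proof -
    have "L2_sq (\<lambda>\<xi>. fourier (h j) \<xi> - fourier (h k) \<xi>) = L2_sq (\<lambda>x. h j x - h k x)"
      using plancherel_L1_L2[of "\<lambda>x. h j x - h k x"] hL1 hL2
      by (simp add: fourier_diff L2_space_diff)
    then show ?thesis
      using rapid(2)[OF that] by simp
  qed
  obtain F where F: "F \<in> L2_space" "L2_tendsto (\<lambda>k. fourier (h k)) F"
    by (rule riesz_fischer[OF fourier_L2_space[OF hL2 hL1] cauchy])
  have "is_L2_fourier f F"
    unfolding is_L2_fourier_def by (intro conjI exI[of _ h] allI F rapid(1) hL1 hL2)
  then show ?thesis by blast
qed

lemma is_L2_fourier_isometry:
  assumes f: "f \<in> L2_space" and F: "is_L2_fourier f F"
  shows "L2_sq F = L2_sq f"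
proof -
  obtain fs where fs: "\<And>k. fs k \<in> L2_space" "\<And>k. integrable lborel (fs k)"
    "L2_tendsto fs f" "L2_tendsto (\<lambda>k. fourier (fs k)) F" and FL: "F \<in> L2_space"
    using F by (auto simp: is_L2_fourier_def)
  have m: "f \<in> borel_measurable borel" "F \<in> borel_measurable borel"
      "fs k \<in> borel_measurable borel" "fourier (fs k) \<in> borel_measurable borel" for k
    using f FL fs(1) fourier_L2_space[OF fs(1,2)] by (auto simp: L2_space_iff)
  show ?thesis
    using L2_sq_le_limit[of f F fs "\<lambda>k. fourier (fs k)", OF m fs(3,4)]
      L2_sq_le_limit[of F f "\<lambda>k. fourier (fs k)" fs, OF m(2,1,4,3) fs(4,3)]
      plancherel_L1_L2[OF fs(1,2)]
    by (intro antisym) auto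
qed

lemma is_L2_fourier_diff:
  assumes f: "f \<in> L2_space" and g: "g \<in> L2_space" and F: "is_L2_fourier f F" and G: "is_L2_fourier g G"
  shows "is_L2_fourier (\<lambda>x. f x - g x) (\<lambda>\<xi>. F \<xi> - G \<xi>)"
proof -
  obtain fs where fs: "\<And>k. fs k \<in> L2_space" "\<And>k. integrable lborel (fs k)"
    "L2_tendsto fs f" "L2_tendsto (\<lambda>k. fourier (fs k)) F" and FL: "F \<in> L2_space"
    using F by (auto simp: is_L2_fourier_def)
  obtain gs where gs: "\<And>k. gs k \<in> L2_space" "\<And>k. integrable lborel (gs k)"
    "L2_tendsto gs g" "L2_tendsto (\<lambda>k. fourier (gs k)) G" and GL: "G \<in> L2_space"
    using G by (auto simp: is_L2_fourier_def)
  show ?thesis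
    unfolding is_L2_fourier_def
  proof (intro conjI exI[of _ "\<lambda>k x. fs k x - gs k x"] allI)
    show "L2_tendsto (\<lambda>k. fourier (\<lambda>x. fs k x - gs k x)) (\<lambda>\<xi>. F \<xi> - G \<xi>)"
      unfolding fourier_diff[OF fs(2) gs(2)]
      by (intro L2_tendsto_diff fourier_L2_space fs gs FL GL)
  qed (intro L2_space_diff L2_tendsto_diff Bochner_Integration.integrable_diff FL GL fs gs f g)+
qed

text \<open>The existence argument in reverse: transforms \<open>fourier (b k)\<close> approximate
  \<open>G\<close>, and Plancherel pulls their Cauchy rate back to the functions \<open>b k\<close>,
  whose limit is the preimage.\<close>

lemma is_L2_fourier_surj:
  assumes G: "G \<in> L2_space"
  shows "\<exists>f \<in> L2_space. is_L2_fourier f G"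
proof -
  have "\<exists>b. b \<in> L2_space \<and> integrable lborel b \<and> L2_sq (\<lambda>x. G x - fourier b x) < ennreal (1 / (4 * 8 ^ k))" for k :: nat
    using fourier_range_dense[OF G, of "ennreal (1 / (4 * 8 ^ k))"] by (simp add: Bex_def)
  then obtain b where b: "\<And>k. b k \<in> L2_space" "\<And>k. integrable lborel (b k)"
    "\<And>k. L2_sq (\<lambda>x. G x - fourier (b k) x) < ennreal (1 / (4 * 8 ^ k))"
    using choice[of "\<lambda>k b. b \<in> L2_space \<and> integrable lborel b \<and> L2_sq (\<lambda>x. G x - fourier b x) < ennreal (1 / (4 * 8 ^ k))"]
    by blast
  have m: "G \<in> borel_measurable borel" "fourier (b k) \<in> borel_measurable borel" for k
    using G fourier_L2_space[OF b(1,2)] by (auto simp: L2_space_iff)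
  note rapid = rapid_tendsto[OF m less_imp_le[OF b(3)]]
  have cauchy: "L2_sq (\<lambda>x. b j x - b k x) \<le> ennreal (1 / 8 ^ k)" if "k \<le> j" for k j
  proof -
    have "L2_sq (\<lambda>\<xi>. fourier (b j) \<xi> - fourier (b k) \<xi>) = L2_sq (\<lambda>x. b j x - b k x)"
      using plancherel_L1_L2[of "\<lambda>x. b j x - b k x"] b(1,2)
      by (simp add: fourier_diff L2_space_diff)
    then show ?thesis
      using rapid(2)[OF that] by simp
  qed
  obtain f where f: "f \<in> L2_space" "L2_tendsto b f"
    by (rule riesz_fischer[OF b(1) cauchy])
  have "is_L2_fourier f G"
    unfolding is_L2_fourier_def by (intro conjI exI[of _ b] allI f G rapid(1) b(1,2))
  with f(1) show ?thesis by (intro bexI)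
qed

lemma L2_fourier_is:
  assumes "f \<in> L2_space"
  shows "is_L2_fourier f (L2_fourier f)"
  unfolding L2_fourier_def is_L2_fourier_def[symmetric]
  by (rule someI_ex[OF is_L2_fourier_exists[OF assms]])

lemma L2_fourier_L2_space:
  "f \<in> L2_space \<Longrightarrow> L2_fourier f \<in> L2_space"
  using L2_fourier_is by (auto simp: is_L2_fourier_def)

lemma L2_fourier_plancherel:
  "f \<in> L2_space \<Longrightarrow> L2_sq (L2_fourier f) = L2_sq f"
  by (rule is_L2_fourier_isometry[OF _ L2_fourier_is])

text \<open>The difference of two candidates is a transform of f - f, so the isometry gives it norm
  0.\<close>

lemma L2_fourier_unique:
  assumes f: "f \<in> L2_space" and F: "is_L2_fourier f F"
  shows "AE \<xi> in lborel. L2_fourier f \<xi> = F \<xi>"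
proof -
  have FL: "F \<in> L2_space"
    using F by (simp add: is_L2_fourier_def)
  have "L2_sq (\<lambda>\<xi>. L2_fourier f \<xi> - F \<xi>) = L2_sq (\<lambda>x. f x - f x)"
    by (intro is_L2_fourier_isometry L2_space_diff is_L2_fourier_diff L2_fourier_is f F)
  then have "L2_sq (\<lambda>\<xi>. L2_fourier f \<xi> - F \<xi>) = 0"
    by (simp add: L2_sq_def)
  then show ?thesis
    using L2_space_diff[OF L2_fourier_L2_space[OF f] FL] by (simp add: L2_sq_eq_0_iff L2_space_iff)
qed

lemma L2_fourier_inj:
  assumes f: "f \<in> L2_space" and g: "g \<in> L2_space"
    and eq: "AE \<xi> in lborel. L2_fourier f \<xi> = L2_fourier g \<xi>"
  shows "AE x in lborel. f x = g x"
proof -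
  have "L2_sq (\<lambda>\<xi>. L2_fourier f \<xi> - L2_fourier g \<xi>) = L2_sq (\<lambda>x. f x - g x)"
    by (intro is_L2_fourier_isometry L2_space_diff is_L2_fourier_diff L2_fourier_is f g)
  moreover have "L2_sq (\<lambda>\<xi>. L2_fourier f \<xi> - L2_fourier g \<xi>) = 0"
    using eq L2_space_diff[OF L2_fourier_L2_space[OF f] L2_fourier_L2_space[OF g]]
    by (simp add: L2_sq_eq_0_iff L2_space_iff)
  ultimately show ?thesis
    using L2_space_diff[OF f g] by (simp add: L2_sq_eq_0_iff L2_space_iff)
qed

text \<open>Equality holds at every point: the chosen predicate sees its argument only through
  \<open>L2_tendsto\<close>, which ignores null sets, so both choices are made from the same
  predicate.\<close>

lemma L2_fourier_cong:
  assumes eq: "AE x in lborel. f x = g x"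
  shows "L2_fourier f = L2_fourier g"
proof -
  have "L2_tendsto fs f \<longleftrightarrow> L2_tendsto fs g" for fs
  proof -
    have "L2_sq (\<lambda>x. fs k x - f x) = L2_sq (\<lambda>x. fs k x - g x)" for k
    proof (rule L2_sq_cong_AE)
      show "AE x in lborel. fs k x - f x = fs k x - g x"
        using eq by eventually_elim simp
    qed
    then show ?thesis
      by (simp add: L2_tendsto_iff)
  qed
  then show ?thesis
    by (simp add: L2_fourier_def)
qed

lemma L2_inv_fourier:
  assumes G: "G \<in> L2_space"
  shows L2_inv_fourier_L2_space: "L2_inv_fourier G \<in> L2_space"
    and L2_fourier_inv: "AE \<xi> in lborel. L2_fourier (L2_inv_fourier G) \<xi> = G \<xi>"
proof -
  obtain f where f: "f \<in> L2_space" "is_L2_fourier f G"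
    using is_L2_fourier_surj[OF G] by blast
  let ?P = "\<lambda>f. f \<in> L2_space \<and> (AE \<xi> in lborel. L2_fourier f \<xi> = G \<xi>)"
  have "?P f"
    using f(1) L2_fourier_unique[OF f] by (rule conjI)
  then have "?P (SOME f. ?P f)"
    by (rule someI[of ?P])
  then have "?P (L2_inv_fourier G)"
    by (simp only: L2_inv_fourier_def)
  then show "L2_inv_fourier G \<in> L2_space" "AE \<xi> in lborel. L2_fourier (L2_inv_fourier G) \<xi> = G \<xi>"
    by (rule conjunct1, rule conjunct2)
qed

subsection \<open>The logarithmic source condition\<close>

lemma AE_fourier_multiplier:
  assumes "(\<lambda>\<xi>. complex_of_real (m \<xi>) * L2_fourier w \<xi>) \<in> L2_space"
  shows "fourier_multiplier m w \<in> L2_space"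
    and "AE \<xi> in lborel. L2_fourier (fourier_multiplier m w) \<xi> = complex_of_real (m \<xi>) * L2_fourier w \<xi>"
  unfolding fourier_multiplier_def using L2_inv_fourier[OF assms] by simp_all

section \<open>Comparison of the source symbol with the Sobolev weight\<close>

lemma set_integral_pos:
  fixes \<gamma> :: "real \<Rightarrow> real"
  assumes "T > 0" and int: "set_integrable lebesgue {0<..<T} \<gamma>" and pos: "\<forall>t\<in>{0<..<T}. \<gamma> t > 0"
  shows "(LINT t:{0<..<T}|lebesgue. \<gamma> t) > 0"
proof -
  let ?f = "\<lambda>t. indicator {0<..<T} t *\<^sub>R \<gamma> t"
  have f: "integrable lebesgue ?f" and nn: "AE t in lebesgue. 0 \<le> ?f t"
    using int pos by (auto simp: set_integrable_def less_imp_le indicator_def intro!: AE_I2)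
  have "(LINT t|lebesgue. ?f t) \<noteq> 0"
  proof
    assume "(LINT t|lebesgue. ?f t) = 0"
    then have "AE t in lebesgue. ?f t = 0"
      using integral_nonneg_eq_0_iff_AE[OF f nn] by simp
    then have "AE t in lebesgue. t \<notin> {0<..<T}"
      by eventually_elim (use pos in \<open>fastforce simp: indicator_def split: if_splits\<close>)
    then have "AE t in lborel. t \<notin> {0<..<T}"
      by (simp only: AE_completion_iff)
    then have "{0<..<T} \<in> null_sets lborel"
      by (subst AE_iff_null_sets) auto
    then show False
      using \<open>T > 0\<close> by (auto dest: null_setsD1)
  qed
  moreover have "(LINT t|lebesgue. ?f t) \<ge> 0"
    by (rule integral_nonneg_AE[OF nn])
  ultimately show ?thesis
    by (simp add: set_lebesgue_integral_def)
qed

text \<open>Here \<open>y\<close> stands for |xi|^2. The upper bound uses that both 1 and y^tau are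
  at most (1+y)^tau. For the lower bound, 1+y is at most 2 max(1,y), and 2^tau is at most 2 since
  tau is at most 1.\<close>

lemma bracket_powr_bounds:
  fixes y M \<tau> :: real
  assumes y: "y \<ge> 0" and M: "M > 0" and \<tau>: "0 < \<tau>" "\<tau> \<le> 1"
  shows "1 + M * y powr \<tau> \<le> (1 + M) * (1 + y) powr \<tau>"
    and "(min 1 M / 2) * (1 + y) powr \<tau> \<le> 1 + M * y powr \<tau>"
proof -
  have "y powr \<tau> \<le> (1 + y) powr \<tau>"
    using y \<tau> by (intro powr_mono2) auto
  then have "M * y powr \<tau> \<le> M * (1 + y) powr \<tau>"
    using M by simp
  moreover have "1 \<le> (1 + y) powr \<tau>"
    using y \<tau> by (intro ge_one_powr_ge_zero) auto
  ultimately show "1 + M * y powr \<tau> \<le> (1 + M) * (1 + y) powr \<tau>"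
    by (simp add: distrib_right)
  have "(1 + y) powr \<tau> \<le> (2 * max 1 y) powr \<tau>"
    using y \<tau> by (intro powr_mono2) auto
  also have "\<dots> = 2 powr \<tau> * max 1 y powr \<tau>"
    by (simp add: powr_mult)
  also have "\<dots> \<le> 2 * (1 + y powr \<tau>)"
  proof (intro mult_mono)
    show "2 powr \<tau> \<le> 2"
      using powr_mono[of \<tau> 1 "2::real"] \<tau> by simp
    show "max 1 y powr \<tau> \<le> 1 + y powr \<tau>"
      using y by (auto simp: max_def)
  qed auto
  finally have "(min 1 M / 2) * (1 + y) powr \<tau> \<le> (min 1 M / 2) * (2 * (1 + y powr \<tau>))"
    using M by (intro mult_left_mono) auto
  also have "\<dots> = min 1 M + min 1 M * y powr \<tau>"
    by (simp add: algebra_simps)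
  also have "\<dots> \<le> 1 + M * y powr \<tau>"
    by (intro add_mono mult_right_mono) auto
  finally show "(min 1 M / 2) * (1 + y) powr \<tau> \<le> 1 + M * y powr \<tau>" .
qed

text \<open>The logarithm undoes the exponential in \<open>psi\<close>: the square contributes the
  factor 2, and the division by e contributes the summand 1.\<close>

lemma log_index_psi:
  "log_index q ((psi T \<tau> \<gamma> \<xi>)\<^sup>2 / exp 1) =
    (1 + 2 * (2 * pi) powr (2 * \<tau>) * (LINT t:{0<..<T}|lebesgue. \<gamma> t) * ((norm \<xi>)\<^sup>2) powr \<tau>) powr (- q)"
proof -
  have "norm ((2 * pi) *\<^sub>R \<xi>) powr (2 * \<tau>) = (2 * pi) powr (2 * \<tau>) * ((norm \<xi>)\<^sup>2) powr \<tau>"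
  proof -
    have "((norm \<xi>)\<^sup>2) powr \<tau> = norm \<xi> powr (2 * \<tau>)"
      by (cases "\<xi> = 0") (simp_all add: powr_powr flip: powr_numeral)
    then show ?thesis
      by (simp add: powr_mult)
  qed
  then show ?thesis
    by (simp add: log_index_def psi_def ln_div ln_realpow mult_ac add_ac)
qed

text \<open>With p = 2 tau q the power of the bracket is the Sobolev weight. The last two bounds are
  raised from \<open>bracket_powr_bounds\<close> to the power 2q, and each drives one of the two
  implications.\<close>

lemma symbol_bounds:
  fixes T \<tau> q :: real and \<gamma> :: "real \<Rightarrow> real"
  defines "M \<equiv> 2 * (2 * pi) powr (2 * \<tau>) * (LINT t:{0<..<T}|lebesgue. \<gamma> t)"
  defines "s \<equiv> \<lambda>\<xi>::'a::euclidean_space. log_index q ((psi T \<tau> \<gamma> \<xi>)\<^sup>2 / exp 1)"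
  assumes \<gamma>: "(LINT t:{0<..<T}|lebesgue. \<gamma> t) > 0" and \<tau>: "0 < \<tau>" "\<tau> \<le> 1" and q: "q > 0"
  shows "0 < s \<xi>" "s \<xi> \<le> 1"
    and "1 \<le> (1 + M) powr (2 * q) * ((1 + (norm \<xi>)\<^sup>2) powr (2 * \<tau> * q) * (s \<xi>)\<^sup>2)"
    and "(1 + (norm \<xi>)\<^sup>2) powr (2 * \<tau> * q) * (s \<xi>)\<^sup>2 \<le> (min 1 M / 2) powr (- 2 * q)"
proof -
  have M: "M > 0"
    using \<gamma> by (simp add: M_def)
  let ?y = "(norm \<xi>)\<^sup>2"
  let ?B = "1 + M * ?y powr \<tau>"
  have s: "s \<xi> = ?B powr (- q)"
    by (simp add: s_def M_def log_index_psi)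
  have B: "?B \<ge> 1"
    using M by simp
  show "0 < s \<xi>"
    using B by (simp add: s)
  have "?B powr (- q) \<le> ?B powr 0"
    using B q by (intro powr_mono) auto
  then show "s \<xi> \<le> 1"
    using B by (simp add: s)
  have s2: "(s \<xi>)\<^sup>2 = ?B powr (- 2 * q)"
    using B by (simp add: s power2_eq_square flip: powr_add)
  have p: "(1 + ?y) powr (2 * \<tau> * q) = ((1 + ?y) powr \<tau>) powr (2 * q)"
    by (simp add: powr_powr mult_ac)
  note b = bracket_powr_bounds[OF zero_le_power2 M \<tau>, of "norm \<xi>"]
  have pos: "(1 + ?y) powr \<tau> > 0"
    by (simp add: add_pos_nonneg order_less_imp_not_eq2)
  have "?B powr (2 * q) \<le> ((1 + M) * (1 + ?y) powr \<tau>) powr (2 * q)"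
    using B q by (intro powr_mono2 b) auto
  also have "\<dots> = (1 + M) powr (2 * q) * (1 + ?y) powr (2 * \<tau> * q)"
    unfolding p using M by (simp add: powr_mult)
  finally have "?B powr (2 * q) * ?B powr (- 2 * q) \<le>
      (1 + M) powr (2 * q) * (1 + ?y) powr (2 * \<tau> * q) * ?B powr (- 2 * q)"
    by (intro mult_right_mono) auto
  moreover have "?B powr (2 * q) * ?B powr (- 2 * q) = 1"
    using B by (simp flip: powr_add)
  ultimately show "1 \<le> (1 + M) powr (2 * q) * ((1 + ?y) powr (2 * \<tau> * q) * (s \<xi>)\<^sup>2)"
    by (simp add: s2 mult_ac)
  let ?m = "min 1 M / 2"
  have m: "?m > 0"
    using M by simp
  \<comment> \<open>The exponent is negative, so the lower bound on the bracket becomes an upper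
    bound.\<close>
  have "?B powr (- 2 * q) \<le> (?m * (1 + ?y) powr \<tau>) powr (- 2 * q)"
    using m pos q by (intro powr_mono2' b) auto
  also have "\<dots> = ?m powr (- 2 * q) * ((1 + ?y) powr \<tau>) powr (- 2 * q)"
    by (rule powr_mult)
  finally have "(1 + ?y) powr (2 * \<tau> * q) * (s \<xi>)\<^sup>2 \<le>
     ((1 + ?y) powr \<tau>) powr (2 * q) * (?m powr (- 2 * q) * ((1 + ?y) powr \<tau>) powr (- 2 * q))"
    unfolding s2 p by (intro mult_left_mono) auto
  also have "\<dots> = ?m powr (- 2 * q) * (((1 + ?y) powr \<tau>) powr (2 * q) * ((1 + ?y) powr \<tau>) powr (- 2 * q))"
    by (simp only: mult_ac)
  also have "((1 + ?y) powr \<tau>) powr (2 * q) * ((1 + ?y) powr \<tau>) powr (- 2 * q) = 1"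
    using pos by (subst powr_add[symmetric]) simp
  finally show "(1 + ?y) powr (2 * \<tau> * q) * (s \<xi>)\<^sup>2 \<le> ?m powr (- 2 * q)"
    by simp
qed

lemma psi_measurable [measurable]: "psi T \<tau> \<gamma> \<in> borel_measurable borel"
  unfolding psi_def by measurable

lemma symbol_measurable [measurable]:
  "(\<lambda>\<xi>. log_index q ((psi T \<tau> \<gamma> \<xi>)\<^sup>2 / exp 1)) \<in> borel_measurable borel"
  unfolding log_index_def by measurable

lemma L2_norm_le_iff:
  assumes "f \<in> L2_space" "E \<ge> 0"
  shows "L2_norm f \<le> E \<longleftrightarrow> (LINT x|lborel. (cmod (f x))\<^sup>2) \<le> E\<^sup>2"
  using assms by (simp add: L2_norm_def real_sqrt_le_iff' integral_nonneg_AE)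

lemma L2_fourier_parseval:
  fixes f :: "'a::euclidean_space \<Rightarrow> complex"
  assumes "f \<in> L2_space"
  shows "(LINT \<xi>|lborel. (cmod (L2_fourier f \<xi>))\<^sup>2) = (LINT x|lborel. (cmod (f x))\<^sup>2)"
proof -
  have "(LINT x|lborel. (cmod (g x))\<^sup>2) = enn2real (L2_sq g)" if "g \<in> L2_space" for g :: "'a \<Rightarrow> complex"
    using that by (subst integral_eq_nn_integral) (auto simp: L2_sq_def L2_space_iff)
  then show ?thesis
    using assms L2_fourier_L2_space[OF assms] L2_fourier_plancherel[OF assms] by simp
qed

theorem proposition3:
  fixes T \<tau> p :: real and \<gamma> :: "real \<Rightarrow> real"
  assumes "T > 0" and "0 < \<tau>" and "\<tau> \<le> 1"
    and "set_integrable lebesgue {0<..<T} \<gamma>"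
    and "\<forall>t\<in>{0<..<T}. \<gamma> t > 0"
    and "p > 0"
  shows "\<exists>c C. 0 < c \<and> 0 < C \<and>
    (\<forall>(u0 :: real ^ 'n \<Rightarrow> complex) g E.
      u0 \<in> L2_space \<longrightarrow> g \<in> L2_space \<longrightarrow>
      (AE x in lborel. final_value_op T \<tau> \<gamma> u0 x = g x) \<longrightarrow> E > 0 \<longrightarrow>
        (smoothness_condition p E u0 \<longrightarrow>
           log_source_condition T \<tau> \<gamma> (p / (2 * \<tau>)) (C * E) u0) \<and>
        (log_source_condition T \<tau> \<gamma> (p / (2 * \<tau>)) (c * E) u0 \<longrightarrow>
           smoothness_condition p E u0))"
proof -
  define q where "q = p / (2 * \<tau>)"
  have q: "q > 0" and p: "p = 2 * \<tau> * q"
    using assms by (simp_all add: q_def)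
  define M where "M = 2 * (2 * pi) powr (2 * \<tau>) * (LINT t:{0<..<T}|lebesgue. \<gamma> t)"
  note \<gamma> = set_integral_pos[OF assms(1,4,5)]
  have M: "M > 0"
    using \<gamma> by (simp add: M_def)
  define s where "s \<xi> = log_index q ((psi T \<tau> \<gamma> \<xi>)\<^sup>2 / exp 1)" for \<xi> :: "real ^ 'n"
  have [measurable]: "s \<in> borel_measurable borel"
    unfolding s_def[abs_def] by measurable
  \<comment> \<open>The constants are square roots of those in \<open>symbol_bounds\<close>, which
    concern squared moduli; the bound on the weighted symbol is the inverse square of
    \<open>c\<close>.\<close>
  define C where "C = (1 + M) powr q"
  define c where "c = (min 1 M / 2) powr q"
  have C2: "(1 + M) powr (2 * q) = C\<^sup>2" and c2: "(min 1 M / 2) powr (- 2 * q) = inverse (c\<^sup>2)"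
    using M by (simp_all add: C_def c_def power2_eq_square powr_minus flip: powr_add)
  have C: "C > 0" and c: "c > 0"
    using M by (simp_all add: C_def c_def)
  note bounds = symbol_bounds[OF \<gamma> assms(2,3) q, where 'a = "real ^ 'n",
      folded M_def s_def p, unfolded C2 c2]
  let ?b = "\<lambda>\<xi>::real ^ 'n. (1 + (norm \<xi>)\<^sup>2) powr p"
  \<comment> \<open>The symbol is at most 1, so multiplication by it preserves
    \<open>L2_space\<close> and the choice in \<open>fourier_multiplier\<close> has a
    witness.\<close>
  have mult: "(\<lambda>\<xi>. complex_of_real (s \<xi>) * L2_fourier w \<xi>) \<in> L2_space" if w: "w \<in> L2_space" for w
  proof -
    have [measurable]: "L2_fourier w \<in> borel_measurable borel"
      and i: "integrable lborel (\<lambda>\<xi>. (cmod (L2_fourier w \<xi>))\<^sup>2)"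
      using L2_fourier_L2_space[OF w] by (auto simp: L2_space_def)
    have "(cmod (complex_of_real (s \<xi>) * L2_fourier w \<xi>))\<^sup>2 \<le> (cmod (L2_fourier w \<xi>))\<^sup>2" for \<xi>
      using bounds(1,2)[of \<xi>] by (intro power_mono) (auto simp: norm_mult intro!: mult_left_le_one_le)
    then have "integrable lborel (\<lambda>\<xi>. (cmod (complex_of_real (s \<xi>) * L2_fourier w \<xi>))\<^sup>2)"
      by (intro Bochner_Integration.integrable_bound[OF i]) auto
    then show ?thesis
      by (simp add: L2_space_def)
  qed
  have op: "normal_op_calculus T \<tau> \<gamma> (log_index q) = fourier_multiplier s"
    by (simp add: normal_op_calculus_def s_def[abs_def])
  have 1: "log_source_condition T \<tau> \<gamma> q (C * E) u"
    if u: "u \<in> L2_space" and E: "E > 0" and smooth: "smoothness_condition p E u" for u :: "real ^ 'n \<Rightarrow> complex" and E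
  proof -
    let ?U = "L2_fourier u"
    have [measurable]: "?U \<in> borel_measurable borel"
      using L2_fourier_L2_space[OF u] by (simp add: L2_space_def)
    have i: "integrable lborel (\<lambda>\<xi>. ?b \<xi> * (cmod (?U \<xi>))\<^sup>2)"
      and le: "sqrt (LINT \<xi>|lborel. ?b \<xi> * (cmod (?U \<xi>))\<^sup>2) \<le> E"
      using smooth by (auto simp: smoothness_condition_def sobolev_space_def sobolev_norm_def)
    have le: "(LINT \<xi>|lborel. ?b \<xi> * (cmod (?U \<xi>))\<^sup>2) \<le> E\<^sup>2"
      using sqrt_le_D[OF le] .
    \<comment> \<open>The source equation forces the transform of \<open>w\<close> up to null sets.
      Division by the positive symbol is unbounded, but the Sobolev weight controls it.\<close>
    define W where "W \<xi> = ?U \<xi> / complex_of_real (s \<xi>)" for \<xi>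
    have [measurable]: "W \<in> borel_measurable borel"
      unfolding W_def by measurable
    have W: "(cmod (W \<xi>))\<^sup>2 \<le> C\<^sup>2 * (?b \<xi> * (cmod (?U \<xi>))\<^sup>2)" for \<xi>
    proof -
      have "(cmod (W \<xi>))\<^sup>2 = 1 * ((cmod (?U \<xi>))\<^sup>2 / (s \<xi>)\<^sup>2)"
        using bounds(1)[of \<xi>] by (simp add: W_def norm_divide power_divide)
      also have "\<dots> \<le> C\<^sup>2 * (?b \<xi> * (s \<xi>)\<^sup>2) * ((cmod (?U \<xi>))\<^sup>2 / (s \<xi>)\<^sup>2)"
        by (intro mult_right_mono bounds) auto
      also have "\<dots> = C\<^sup>2 * (?b \<xi> * (cmod (?U \<xi>))\<^sup>2)"
        using bounds(1)[of \<xi>] by simp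
      finally show ?thesis .
    qed
    have Wi: "integrable lborel (\<lambda>\<xi>. (cmod (W \<xi>))\<^sup>2)"
      by (rule Bochner_Integration.integrable_bound[OF integrable_mult_right[OF i, of "C\<^sup>2"]])
        (use W order_trans[OF _ abs_ge_self] in auto)
    then have WL: "W \<in> L2_space"
      by (simp add: L2_space_def)
    have "(LINT \<xi>|lborel. (cmod (W \<xi>))\<^sup>2) \<le> (LINT \<xi>|lborel. C\<^sup>2 * (?b \<xi> * (cmod (?U \<xi>))\<^sup>2))"
      by (intro integral_mono Wi integrable_mult_right i W)
    also have "\<dots> \<le> C\<^sup>2 * E\<^sup>2"
      using le by (simp add: mult_left_mono)
    finally have Wle: "(LINT \<xi>|lborel. (cmod (W \<xi>))\<^sup>2) \<le> (C * E)\<^sup>2"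
      by (simp add: power_mult_distrib)
    define w where "w = L2_inv_fourier W"
    have wL: "w \<in> L2_space" and wW: "AE \<xi> in lborel. L2_fourier w \<xi> = W \<xi>"
      unfolding w_def by (rule L2_inv_fourier[OF WL])+
    have "(LINT x|lborel. (cmod (w x))\<^sup>2) = (LINT \<xi>|lborel. (cmod (L2_fourier w \<xi>))\<^sup>2)"
      by (rule L2_fourier_parseval[OF wL, symmetric])
    also have "\<dots> = (LINT \<xi>|lborel. (cmod (W \<xi>))\<^sup>2)"
    proof (rule integral_cong_AE)
      show "(\<lambda>\<xi>. (cmod (L2_fourier w \<xi>))\<^sup>2) \<in> borel_measurable lborel"
        using L2_fourier_L2_space[OF wL] by (auto simp: L2_space_def)
      show "AE \<xi> in lborel. (cmod (L2_fourier w \<xi>))\<^sup>2 = (cmod (W \<xi>))\<^sup>2"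
        using wW by eventually_elim simp
    qed measurable
    finally have wle: "L2_norm w \<le> C * E"
      using Wle C E by (simp add: L2_norm_le_iff[OF wL])
    note m = AE_fourier_multiplier[OF mult[OF wL]]
    have "AE x in lborel. u x = fourier_multiplier s w x"
    proof (rule L2_fourier_inj[OF u m(1)])
      show "AE \<xi> in lborel. ?U \<xi> = L2_fourier (fourier_multiplier s w) \<xi>"
        using m(2) wW
      proof eventually_elim
        case (elim \<xi>)
        then show ?case
          using bounds(1)[of \<xi>] by (simp add: W_def)
      qed
    qed
    then show ?thesis
      unfolding log_source_condition_def op using wL wle by blast
  qed
  have 2: "smoothness_condition p E u"
    if u: "u \<in> L2_space" and E: "E > 0" and source: "log_source_condition T \<tau> \<gamma> q (c * E) u" for u :: "real ^ 'n \<Rightarrow> complex" and E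
  proof -
    let ?U = "L2_fourier u"
    have [measurable]: "?U \<in> borel_measurable borel"
      using L2_fourier_L2_space[OF u] by (simp add: L2_space_def)
    obtain w where wL: "w \<in> L2_space" and uw: "AE x in lborel. u x = fourier_multiplier s w x"
      and wle: "L2_norm w \<le> c * E"
      using source unfolding log_source_condition_def op by blast
    have wE: "(LINT x|lborel. (cmod (L2_fourier w x))\<^sup>2) \<le> (c * E)\<^sup>2"
      using wle c E by (simp add: L2_norm_le_iff[OF wL] L2_fourier_parseval[OF wL])
    have wi: "integrable lborel (\<lambda>\<xi>. (cmod (L2_fourier w \<xi>))\<^sup>2)"
      using L2_fourier_L2_space[OF wL] by (simp add: L2_space_def)
    \<comment> \<open>The source condition determines \<open>u\<close> only up to null sets, yet
      \<open>L2_fourier_cong\<close> allows its transform to be replaced outright.\<close>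
    have "AE \<xi> in lborel. ?U \<xi> = complex_of_real (s \<xi>) * L2_fourier w \<xi>"
      unfolding L2_fourier_cong[OF uw] by (rule AE_fourier_multiplier(2)[OF mult[OF wL]])
    then have le: "AE \<xi> in lborel. ?b \<xi> * (cmod (?U \<xi>))\<^sup>2 \<le> inverse (c\<^sup>2) * (cmod (L2_fourier w \<xi>))\<^sup>2"
    proof eventually_elim
      case (elim \<xi>)
      have "?b \<xi> * (cmod (?U \<xi>))\<^sup>2 = ?b \<xi> * (s \<xi>)\<^sup>2 * (cmod (L2_fourier w \<xi>))\<^sup>2"
        by (simp add: elim norm_mult power_mult_distrib)
      also have "\<dots> \<le> inverse (c\<^sup>2) * (cmod (L2_fourier w \<xi>))\<^sup>2"
        by (intro mult_right_mono bounds) auto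
      finally show ?case .
    qed
    note cwi = integrable_mult_right[OF wi, of "inverse (c\<^sup>2)"]
    have i: "integrable lborel (\<lambda>\<xi>. ?b \<xi> * (cmod (?U \<xi>))\<^sup>2)"
    proof (rule Bochner_Integration.integrable_bound[OF cwi])
      show "AE \<xi> in lborel. norm (?b \<xi> * (cmod (?U \<xi>))\<^sup>2) \<le> norm (inverse (c\<^sup>2) * (cmod (L2_fourier w \<xi>))\<^sup>2)"
        using le by eventually_elim (simp add: abs_mult)
    qed measurable
    have "(LINT \<xi>|lborel. ?b \<xi> * (cmod (?U \<xi>))\<^sup>2) \<le> (LINT \<xi>|lborel. inverse (c\<^sup>2) * (cmod (L2_fourier w \<xi>))\<^sup>2)"
      by (rule integral_mono_AE[OF i cwi le])
    also have "\<dots> = inverse (c\<^sup>2) * (LINT \<xi>|lborel. (cmod (L2_fourier w \<xi>))\<^sup>2)"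
      by simp
    also have "\<dots> \<le> inverse (c\<^sup>2) * (c * E)\<^sup>2"
      by (intro mult_left_mono wE) auto
    also have "\<dots> = E\<^sup>2"
      using c by (simp add: power_mult_distrib)
    finally have "sqrt (LINT \<xi>|lborel. ?b \<xi> * (cmod (?U \<xi>))\<^sup>2) \<le> E"
      using E by (intro real_le_lsqrt) (auto intro: integral_nonneg_AE)
    then show ?thesis
      using i u by (simp add: smoothness_condition_def sobolev_space_def sobolev_norm_def)
  qed
  show ?thesis
    unfolding q_def[symmetric] using C c 1 2 by blast
qed

end
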